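(* Let $a\in(0,1/2)$ and consider, on $(0,+\infty)^3$, the autonomous system $$\dot x_i=f_i(x_1,x_2,x_3)=\frac{x_i}{x_j}+\frac{x_i}{x_k}-2a\,\frac{2x_i^2-x_j^2-x_k^2}{x_jx_k}-2,\qquad \{i,j,k\}=\{1,2,3\}. \quad (\ast)$$ Let $S$, $\overline S$, $\operatorname{ext}(S)$, $\overline{\operatorname{ext}(S)}$, $I$ and $I'$ be the subsets of $(0,+\infty)^3$ defined in the context. Then the following hold for trajectories of $(\ast)$. (1) If $a\in(0,3/14)$, then every trajectory originating in $\overline S\setminus I'$ reaches $\operatorname{ext}(S)$ once and remains there forever; no trajectory originating in $\operatorname{ext}(S)$ reaches $\overline S$. (2) If $a=3/14$, then every trajectory originating in $\overline S\setminus I$ reaches $\operatorname{ext}(S)$ once and remains there forever; no trajectory originating in $\operatorname{ext}(S)$ reaches $\overline S$. (3) If $a\in(3/14,1/4)$, then there exist trajectories originating in $\overline{\operatorname{ext}(S)}$ which get into $S$ and later return to $\overline{\operatorname{ext}(S)}$; every trajectory originating in $S\setminus I$ reaches $\operatorname{ext}(S)$ once and remains there forever. (4) If $a\in(1/4,1/2)$, then every trajectory originating in $S$ remains in $S$ forever; every trajectory originating in $\overline{\operatorname{ext}(S)}$ gets into $S$. (5) If $a=1/4$, then every trajectory originating in $S$ remains in $S$ forever; there exist trajectories originating in $\overline{\operatorname{ext}(S)}$ which get into $S$.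
   Context: For $\{i,j,k\}=\{1,2,3\}$ put $\gamma_i=(x_j-x_k)^2+2x_i(x_j+x_k)-3x_i^2$, and let $$S=\{(x_1,x_2,x_3)\in(0,+\infty)^3 : \gamma_1>0,\ \gamma_2>0,\ \gamma_3>0\}\setminus\{(r,r,r): r>0\}.$$ Closures $\overline{X}$ and exteriors $\operatorname{ext}(X)$ are taken in the phase space $(0,+\infty)^3$ with the standard topology; $\operatorname{ext}(S)=(0,+\infty)^3\setminus\overline S$. For $c>0$ and $i\in\{1,2,3\}$ let $I_i(c)$ be the curve $x_i=cp^{-2}$, $x_j=x_k=p$, $p>0$ (where $\{i,j,k\}=\{1,2,3\}$), lying on the surface $x_1x_2x_3=c$, and let $I_i'(c)$ be its part with $p\ge\sqrt[3]{c}$. Put $I=\bigcup_{c>0}\bigcup_{i=1}^3 I_i(c)$ (the points of $(0,+\infty)^3$ with at least two equal coordinates) and $I'=\bigcup_{c>0}\bigcup_{i=1}^3I_i'(c)$ (the points with $x_j=x_k\ge x_i$ for some $\{i,j,k\}=\{1,2,3\}$). A trajectory originating in (a point of) a set $X$ is the forward solution $x(t)$, $t\ge 0$, on its maximal interval of existence in $(0,+\infty)^3$, with $x(0)\in X$. "Forever" means for all later times in this maximal interval. "Reaches $\operatorname{ext}(S)$ once and remains there forever" means that there is a time $t_0\ge0$ in the interval of existence, smaller than its right endpoint, such that $x(t)\in\overline S$ for $0\le t\le t_0$ and $x(t)\in\operatorname{ext}(S)$ for all $t>t_0$ in the interval of existence. "Gets into $S$" (or "reaches $\overline S$") means $x(t)\in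 S$ (respectively $x(t)\in \overline S$) for some $t\geq 0$. *)

theory Defs
  imports "HOL-Analysis.Analysis"
begin

(* For i :: 3 the two other indices are i + 1 and i + 2, addition being modulo 3.  The formulas
   below are symmetric in these two indices. *)
lemma UNIV_3_shift: "{i, i + 1, i + 2} = (UNIV :: 3 set)"
proof -
  have "i \<noteq> i + 1" "i \<noteq> i + 2" "i + 1 \<noteq> i + 2" by simp_all
  then have "card {i, i + 1, i + 2} = CARD(3)" by simp
  then show ?thesis by (simp add: card_eq_UNIV_imp_eq_UNIV)
qed

definition phase :: "(real ^ 3) set" where
  "phase = {x. \<forall>i. 0 < x $ i}"

definition vfield :: "real \<Rightarrow> real ^ 3 \<Rightarrow> real ^ 3" where
  "vfield a x = (\<chi> i. x $ i / x $ (i + 1) + x $ i / x $ (i + 2)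
      - 2 * a * ((2 * (x $ i)\<^sup>2 - (x $ (i + 1))\<^sup>2 - (x $ (i + 2))\<^sup>2)
                   / (x $ (i + 1) * x $ (i + 2))) - 2)"

definition gam :: "3 \<Rightarrow> real ^ 3 \<Rightarrow> real" where
  "gam i x = (x $ (i + 1) - x $ (i + 2))\<^sup>2
      + 2 * x $ i * (x $ (i + 1) + x $ (i + 2)) - 3 * (x $ i)\<^sup>2"

definition S_set :: "(real ^ 3) set" where
  "S_set = {x \<in> phase. \<forall>i. 0 < gam i x} - {vec r | r. 0 < r}"

definition phase_closure :: "(real ^ 3) set \<Rightarrow> (real ^ 3) set" where
  "phase_closure X = top_of_set phase closure_of X"

definition phase_ext :: "(real ^ 3) set \<Rightarrow> (real ^ 3) set" where
  "phase_ext X = phase - phase_closure X"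

definition I_curve :: "3 \<Rightarrow> real \<Rightarrow> (real ^ 3) set" where
  "I_curve i c = {x. \<exists>p>0. x $ i = c / p\<^sup>2 \<and> (\<forall>j. j \<noteq> i \<longrightarrow> x $ j = p)}"

definition I_curve' :: "3 \<Rightarrow> real \<Rightarrow> (real ^ 3) set" where
  "I_curve' i c = {x. \<exists>p>0. root 3 c \<le> p \<and> x $ i = c / p\<^sup>2 \<and> (\<forall>j. j \<noteq> i \<longrightarrow> x $ j = p)}"

definition I_set :: "(real ^ 3) set" where
  "I_set = (\<Union>c\<in>{0<..}. \<Union>i. I_curve i c)"

definition I_set' :: "(real ^ 3) set" where
  "I_set' = (\<Union>c\<in>{0<..}. \<Union>i. I_curve' i c)"

definition time_interval :: "ereal \<Rightarrow> real set" where
  "time_interval T = {t. 0 \<le> t \<and> ereal t < T}"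

definition solution :: "real \<Rightarrow> ereal \<Rightarrow> (real \<Rightarrow> real ^ 3) \<Rightarrow> bool" where
  "solution a T x \<longleftrightarrow> (\<forall>t\<in>time_interval T.
      x t \<in> phase \<and> (x has_vector_derivative vfield a (x t)) (at t within time_interval T))"

(* The forward solution on its maximal interval of existence [0, T): it is not the restriction of
   a solution on a longer interval.  As the field is smooth on the open set phase, a maximal
   interval of existence is always open on the right, so no other intervals are needed.  The
   values of x outside [0, T) are irrelevant. *)
definition trajectory :: "real \<Rightarrow> ereal \<Rightarrow> (real \<Rightarrow> real ^ 3) \<Rightarrow> bool" where
  "trajectory a T x \<longleftrightarrow> 0 < T \<and> solution a T x \<and>
      \<not> (\<exists>T' y. T < T' \<and> solution a T' y \<and> (\<forall>t\<in>time_interval T. y t = x t))"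

definition reaches_ext_once :: "ereal \<Rightarrow> (real \<Rightarrow> real ^ 3) \<Rightarrow> bool" where
  "reaches_ext_once T x \<longleftrightarrow> (\<exists>t0\<in>time_interval T.
      (\<forall>t\<in>{0..t0}. x t \<in> phase_closure S_set) \<and>
      (\<forall>t\<in>time_interval T. t0 < t \<longrightarrow> x t \<in> phase_ext S_set))"

definition reaches :: "ereal \<Rightarrow> (real \<Rightarrow> real ^ 3) \<Rightarrow> (real ^ 3) set \<Rightarrow> bool" where
  "reaches T x X \<longleftrightarrow> (\<exists>t\<in>time_interval T. x t \<in> X)"

definition remains :: "ereal \<Rightarrow> (real \<Rightarrow> real ^ 3) \<Rightarrow> (real ^ 3) set \<Rightarrow> bool" where
  "remains T x X \<longleftrightarrow> (\<forall>t\<in>time_interval T. x t \<in> X)"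

end

theory Submission
  imports Defs
begin

text \<open>Sort the coordinates as \<open>X \<ge> Y \<ge> Z\<close>; each difference of coordinates solves a linear equation,
  so the order and its strictness persist, and only the function \<open>\<gamma>\<close> of the largest coordinate can
  vanish. Along a solution \<open>\<gamma>' = H \<gamma> + F\<close>, where \<open>F\<close> is a positive multiple of
  \<open>(X - Y) (X - Z) \<Psi>\<close>. The sign of \<open>\<Psi>\<close> tells in which direction the surface \<open>\<gamma> = 0\<close> is crossed: it
  is constant unless \<open>3/14 < a < 1/4\<close>, and in that case it is determined by the ratio
  \<open>(X - Y) / (X - Z)\<close>, which never increases, so that it switches at most once, from positive to
  negative. That the surface is actually reached in time follows from the functional
  \<open>ln (X - Y) + 2 ln (X - Z) - ln X - 2 ln Z - K (X - Y) / (X - Z)\<close>: it is strictly monotone and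
  bounded on the relevant side of the surface, and its rate of change dominates that of the
  logarithms of the coordinates, which excludes blow-up.\<close>

section \<open>Existence of trajectories\<close>

text \<open>Both thresholds come from one function. Put u = \<open>sqrt ((X - Y) / (X - Z))\<close>,
  a number between 0 and 1; then \<Psi> / (X - Z) = 2 (26 a - 5) u - (4 - 16 a) (1 + u^2). Its value
  at u = 1, where Y = Z, is 2 (42 a - 9) and changes sign at 3/14; its value at u = 0 is - (4 - 16
  a) and changes sign at 1/4. The exceptional curves have the same explanation: if X = Y, then
  \<gamma> stays positive whatever a is; if Y = Z < X, then \<Psi> is negative for a < 3/14 but zero
  for a = 3/14. The obstacle is that nothing is known about T in advance: a trajectory might run to
  the boundary of the phase space in finite time without meeting the surface, so the functional has
  to settle finite and infinite T together. Its weights 1, 2, -1, -2 add up to 0, as suits a region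
  that is a cone, and they match the estimates X (X - Y) \<le> Z^2, valid where \<gamma> \<ge> 0,
  and X - Z \<le> X. From a = 3/14 on the logarithms alone may fail to grow, first at Y = Z on the
  surface; the ratio term makes up for this.\<close>

lemma linear_ode_comparison:
  fixes y h F :: "real \<Rightarrow> real"
  assumes "s < t" and h: "continuous_on {s..t} h"
    and y: "\<And>r. r \<in> {s..t} \<Longrightarrow> (y has_real_derivative h r * y r + F r) (at r within {s..t})"
  shows "\<exists>m>0. \<exists>e>0. \<exists>r\<in>{s<..<t}. y t = m * y s + e * F r"
proof -
  obtain P where P: "\<And>r. r \<in> {s..t} \<Longrightarrow> (P has_real_derivative h r) (at r within {s..t})"
    using antiderivative_continuous[OF h] unfolding has_real_derivative_iff_has_vector_derivative
    by blast
  \<comment> \<open>Variation of constants, with the mean value theorem in place of the integral: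
    \<open>F\<close> is then evaluated at one time only, and the later uses read off the sign of
    \<open>y t\<close> from those of \<open>y s\<close> and \<open>F r\<close>.\<close>
  have "((\<lambda>r. y r * exp (- P r)) has_real_derivative F r * exp (- P r)) (at r within {s..t})"
    if "r \<in> {s..t}" for r
    by (rule derivative_eq_intros y P that refl)+ (simp add: algebra_simps)
  then have "\<exists>r\<in>{s<..<t}. y t * exp (- P t) - y s * exp (- P s) = F r * exp (- P r) * (t - s)"
    by (intro mvt_simple[where f' = "\<lambda>r x. F r * exp (- P r) * x"] \<open>s < t\<close>)
       (simp add: has_field_derivative_def)
  then obtain r where r: "r \<in> {s<..<t}"
    "y t * exp (- P t) - y s * exp (- P s) = F r * exp (- P r) * (t - s)" ..
  have "y t = y t * exp (- P t) * exp (P t)"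
    by (simp add: exp_minus)
  also have "\<dots> = (y s * exp (- P s) + F r * exp (- P r) * (t - s)) * exp (P t)"
    using r(2) by simp
  also have "\<dots> = exp (P t - P s) * y s + (exp (P t - P r) * (t - s)) * F r"
    by (simp add: exp_diff exp_minus field_simps)
  finally show ?thesis
    using r(1) \<open>s < t\<close>
    by (intro exI[of _ "exp (P t - P s)"] exI[of _ "exp (P t - P r) * (t - s)"] conjI bexI[of _ r])
      auto
qed

text \<open>Banach's fixed point theorem for the integral operator, which \<open>e * L < 1\<close>
  makes a contraction in the supremum norm.\<close>

lemma picard_lipschitz:
  fixes F :: "'a::euclidean_space \<Rightarrow> 'a" and x0 :: 'a
  assumes F: "L-lipschitz_on UNIV F" and "0 < e" and eL: "e * L < 1"
  shows "\<exists>y. y 0 = x0 \<and> (\<forall>t\<in>{0..e}. (y has_vector_derivative F (y t)) (at t within {0..e}))"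
proof -
  have L: "0 \<le> L" using F by (rule lipschitz_on_nonneg)
  have F_cont: "continuous_on X F" for X
    using lipschitz_on_continuous_on[OF F] continuous_on_subset by blast
  have Fy: "continuous_on X (\<lambda>s. F (apply_bcontfun y s))" for X and y :: "real \<Rightarrow>\<^sub>C 'a"
    using continuous_on_compose2[OF F_cont continuous_on_apply_bcontfun] by blast
  define I where "I y t = x0 + integral {0..t} (\<lambda>s. F (apply_bcontfun y s))" for y :: "real \<Rightarrow>\<^sub>C 'a" and t
  \<comment> \<open>The image of \<open>y\<close> is extended by constants beyond both ends of the
    interval, so that the operator acts on the complete space of bounded continuous functions on the
    whole line.\<close>
  have "\<exists>g :: real \<Rightarrow>\<^sub>C 'a. (\<forall>t\<in>{0..e}. g t = I y t) \<and> (\<forall>t. g t = I y (clamp 0 e t))" for y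
  proof -
    have "continuous_on (cbox 0 e) (I y)"
      unfolding I_def cbox_interval
      by (intro continuous_intros indefinite_integral_continuous_1 integrable_continuous_real Fy)
    then show ?thesis
      by (rule continuous_on_cbox_bcontfunE) (metis box_real(2))
  qed
  then obtain \<Phi> where \<Phi>: "\<And>y t. t \<in> {0..e} \<Longrightarrow> apply_bcontfun (\<Phi> y) t = I y t"
    "\<And>y t. apply_bcontfun (\<Phi> y) t = I y (clamp 0 e t)"
    by metis
  have "dist (\<Phi> y) (\<Phi> z) \<le> e * L * dist y z" for y z
  proof (rule dist_bound)
    fix t
    define u where "u = clamp 0 e t"
    have u: "0 \<le> u" "u \<le> e"
      using clamp_in_interval[of 0 e t] \<open>0 < e\<close> by (auto simp: u_def cbox_interval)
    have "dist (\<Phi> y t) (\<Phi> z t) = norm (integral {0..u} (\<lambda>s. F (y s) - F (z s)))"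
      unfolding \<Phi>(2) I_def u_def[symmetric] dist_norm
      by (simp add: Henstock_Kurzweil_Integration.integral_diff integrable_continuous_real Fy)
    also have "\<dots> \<le> (L * dist y z) * (u - 0)"
    proof (rule integral_bound)
      show "norm (F (y s) - F (z s)) \<le> L * dist y z" for s
        using lipschitz_onD[OF F, of "y s" "z s"] mult_left_mono[OF dist_bounded[of y s z] L]
        by (simp add: dist_norm)
      show "continuous_on {0..u} (\<lambda>s. F (y s) - F (z s))"
        by (rule continuous_on_diff[OF Fy Fy])
    qed (rule u)
    also have "\<dots> \<le> e * L * dist y z"
      using mult_right_mono[OF u(2), of "L * dist y z"] L by (simp add: mult_ac)
    finally show "dist (\<Phi> y t) (\<Phi> z t) \<le> e * L * dist y z" .
  qed
  then obtain y where y: "\<Phi> y = y"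
    using banach_fix_type[of "e * L" \<Phi>] \<open>0 < e\<close> L eL by auto
  have "(apply_bcontfun y has_vector_derivative F (y t)) (at t within {0..e})" if "t \<in> {0..e}" for t
  proof (rule has_vector_derivative_transform[OF that])
    show "apply_bcontfun y s = I y s" if "s \<in> {0..e}" for s
      using \<Phi>(1)[OF that, of y] y by simp
    show "(I y has_vector_derivative F (y t)) (at t within {0..e})"
      unfolding I_def
      using has_vector_derivative_add[OF has_vector_derivative_const
        integral_has_vector_derivative[OF Fy that, of y], of x0] by simp
  qed
  moreover have "apply_bcontfun y 0 = x0"
    using \<Phi>(1)[of 0 y] y \<open>0 < e\<close> by (simp add: I_def)
  ultimately show ?thesis by blast
qed

lemma lipschitz_on_mult_bounded:
  fixes f g :: "'a::metric_space \<Rightarrow> real"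
  assumes "\<exists>L. L-lipschitz_on K f" "bounded (f ` K)" "\<exists>L. L-lipschitz_on K g" "bounded (g ` K)"
  shows "\<exists>L. L-lipschitz_on K (\<lambda>x. f x * g x)"
proof -
  obtain L M where L: "L-lipschitz_on K f" "M-lipschitz_on K g" using assms by blast
  obtain A where A: "A > 0" "\<And>x. x \<in> K \<Longrightarrow> \<bar>f x\<bar> \<le> A"
    using assms(2) by (auto simp: bounded_pos)
  obtain B where B: "B > 0" "\<And>x. x \<in> K \<Longrightarrow> \<bar>g x\<bar> \<le> B"
    using assms(4) by (auto simp: bounded_pos)
  have "(A * M + L * B)-lipschitz_on K (\<lambda>x. f x * g x)"
  proof (rule lipschitz_onI)
    show "0 \<le> A * M + L * B"
      using A B lipschitz_on_nonneg[OF L(1)] lipschitz_on_nonneg[OF L(2)] by simp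
    fix x y assume xy: "x \<in> K" "y \<in> K"
    have "dist (f x * g x) (f y * g y) = \<bar>f x * (g x - g y) + (f x - f y) * g y\<bar>"
      by (simp add: dist_real_def algebra_simps)
    also have "\<dots> \<le> \<bar>f x\<bar> * \<bar>g x - g y\<bar> + \<bar>f x - f y\<bar> * \<bar>g y\<bar>"
      by (rule abs_triangle_ineq[THEN order_trans]) (simp add: abs_mult)
    also have "\<dots> \<le> A * (M * dist x y) + (L * dist x y) * B"
      using lipschitz_onD[OF L(1) xy] lipschitz_onD[OF L(2) xy] A B xy
      by (intro add_mono mult_mono)
         (auto simp: dist_real_def intro!: mult_nonneg_nonneg lipschitz_on_nonneg[OF L(1)])
    finally show "dist (f x * g x) (f y * g y) \<le> (A * M + L * B) * dist x y"
      by (simp add: algebra_simps)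
  qed
  then show ?thesis by blast
qed

lemma lipschitz_on_inverse_bounded:
  fixes f :: "'a::metric_space \<Rightarrow> real"
  assumes "\<exists>L. L-lipschitz_on K f" "0 < m" "\<And>x. x \<in> K \<Longrightarrow> m \<le> f x"
  shows "\<exists>L. L-lipschitz_on K (\<lambda>x. inverse (f x))"
proof -
  obtain L where L: "L-lipschitz_on K f" using assms by blast
  have "(L / (m * m))-lipschitz_on K (\<lambda>x. inverse (f x))"
  proof (rule lipschitz_onI)
    show "0 \<le> L / (m * m)" using lipschitz_on_nonneg[OF L] by simp
    fix x y assume xy: "x \<in> K" "y \<in> K"
    have p: "0 < f x" "0 < f y" using assms xy by force+
    have "dist (inverse (f x)) (inverse (f y)) = \<bar>f x - f y\<bar> / (f x * f y)"
      using p by (simp add: dist_real_def inverse_diff_inverse abs_mult abs_minus_commute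
        divide_simps)
    also have "\<dots> \<le> (L * dist x y) / (m * m)"
      using lipschitz_onD[OF L xy] assms xy p
      by (intro frac_le mult_mono) (auto simp: dist_real_def intro!: mult_nonneg_nonneg lipschitz_on_nonneg[OF L])
    finally show "dist (inverse (f x)) (inverse (f y)) \<le> L / (m * m) * dist x y" by simp
  qed
  then show ?thesis by blast
qed

lemma vfield_continuous_on: "K \<subseteq> phase \<Longrightarrow> continuous_on K (vfield a)"
  unfolding vfield_def
  by (intro continuous_intros) (force simp: phase_def dest: subsetD less_imp_neq)+

lemma vfield_lipschitz:
  assumes "compact K" "0 < m" "\<And>x i. x \<in> K \<Longrightarrow> m \<le> x $ i"
  shows "\<exists>L. L-lipschitz_on K (vfield a)"
proof -
  \<comment> \<open>On a compact set a Lipschitz function is bounded, so this class is closed under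
    products and contains the inverses of the coordinates; the field is a polynomial in
    these.\<close>
  define G where "G f \<longleftrightarrow> (\<exists>L. L-lipschitz_on K f) \<and> bounded (f ` K)" for f :: "real ^ 3 \<Rightarrow> real"
  have GI: "G f" if "\<exists>L. L-lipschitz_on K f" for f
  proof -
    have "continuous_on K f" using that lipschitz_on_continuous_on by blast
    then show ?thesis unfolding G_def
      using that compact_imp_bounded[OF compact_continuous_image[OF _ assms(1)]] by blast
  qed
  have mult: "G (\<lambda>x. f x * g x)" if "G f" "G g" for f g
    using that by (intro GI lipschitz_on_mult_bounded) (auto simp: G_def)
  have sub: "G (\<lambda>x. f x - g x)" and add: "G (\<lambda>x. f x + g x)" if "G f" "G g" for f g
    by (intro GI; use that lipschitz_on_diff lipschitz_on_add in \<open>unfold G_def, blast\<close>)+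
  have const: "G (\<lambda>x. c)" for c by (auto intro!: GI lipschitz_on_constant)
  have nth: "G (\<lambda>x. x $ i)" for i
    by (auto intro!: GI exI[of _ 1] lipschitz_onI dist_vec_nth_le)
  have inv: "G (\<lambda>x. inverse (x $ i))" for i
    using nth[of i] assms by (intro GI lipschitz_on_inverse_bounded) (auto simp: G_def)
  have "G (\<lambda>x. vfield a x $ i)" for i :: 3
    unfolding vfield_def vec_lambda_beta divide_inverse inverse_mult_distrib power2_eq_square
    by (intro mult sub add const nth inv)
  then obtain L where L: "\<And>i :: 3. (L i)-lipschitz_on K (\<lambda>x. vfield a x $ i)"
    unfolding G_def by metis
  have "(\<Sum>i\<in>UNIV. L i)-lipschitz_on K (vfield a)"
  proof (rule lipschitz_onI)
    show "0 \<le> (\<Sum>i\<in>UNIV. L i)" by (intro sum_nonneg lipschitz_on_nonneg[OF L])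
    fix x y assume xy: "x \<in> K" "y \<in> K"
    have "dist (vfield a x) (vfield a y) \<le> (\<Sum>i\<in>UNIV. \<bar>(vfield a x - vfield a y) $ i\<bar>)"
      unfolding dist_norm by (rule norm_le_l1_cart)
    also have "\<dots> \<le> (\<Sum>i\<in>UNIV. L i * dist x y)"
      using lipschitz_onD[OF L xy] by (intro sum_mono) (simp add: dist_real_def)
    finally show "dist (vfield a x) (vfield a y) \<le> (\<Sum>i\<in>UNIV. L i) * dist x y"
      by (simp add: sum_distrib_right)
  qed
  then show ?thesis by blast
qed

lemma local_solution:
  assumes "x0 \<in> phase"
  shows "\<exists>e>0. \<exists>y. y 0 = x0 \<and> (\<forall>t\<in>{0..e}. y t \<in> phase \<and>
    (y has_vector_derivative vfield a (y t)) (at t within {0..e}))"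
proof -
  \<comment> \<open>Half the smallest coordinate: in the box of radius \<open>m\<close> around
    \<open>x0\<close> every coordinate is still at least \<open>m\<close>.\<close>
  define m where "m = (MIN i. x0 $ i) / 2"
  have m: "0 < m" "\<And>i. 2 * m \<le> x0 $ i"
    using assms by (auto simp: m_def phase_def)
  define lo hi where "lo = x0 - (\<chi> i. m)" and "hi = x0 + (\<chi> i. m)"
  have box: "x \<in> cbox lo hi \<longleftrightarrow> (\<forall>i. \<bar>x $ i - x0 $ i\<bar> \<le> m)" for x
    unfolding mem_box_cart lo_def hi_def by (force simp: abs_le_iff algebra_simps)
  have low: "m \<le> x $ i" if "x \<in> cbox lo hi" for x i
    using that m(2)[of i] unfolding box by (smt (verit, best))
  have in_phase: "cbox lo hi \<subseteq> phase"
    unfolding phase_def using less_le_trans[OF m(1) low] by blast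
  obtain L where L: "L-lipschitz_on (cbox lo hi) (vfield a)"
    using vfield_lipschitz[OF compact_cbox m(1) low] by blast
  have x0: "x0 \<in> cbox lo hi" unfolding box using m by simp
  have clamp_in: "clamp lo hi x \<in> cbox lo hi" for x
    using x0 by (intro clamp_in_interval) (meson order_trans mem_box(2))
  \<comment> \<open>Clamping does not increase distances, so this extension of the field is
    Lipschitz on the whole space. A solution for it solves the original equation as long as it stays
    in the box.\<close>
  define F where "F x = vfield a (clamp lo hi x)" for x
  have F: "L-lipschitz_on UNIV F"
  proof (rule lipschitz_onI)
    show "dist (F x) (F y) \<le> L * dist x y" for x y
      unfolding F_def using lipschitz_onD[OF L clamp_in clamp_in, of x y]
        mult_left_mono[OF dist_clamps_le_dist_args lipschitz_on_nonneg[OF L], of lo hi x y] by simp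
  qed (rule lipschitz_on_nonneg[OF L])
  define d where "d = 1 / (L + 1)"
  have d: "0 < d" "d * L < 1"
    using lipschitz_on_nonneg[OF L] by (auto simp: d_def divide_simps)
  obtain y where y: "y 0 = x0"
    "\<And>t. t \<in> {0..d} \<Longrightarrow> (y has_vector_derivative F (y t)) (at t within {0..d})"
    using picard_lipschitz[OF F d] by blast
  have "continuous_on {0..d} y"
    using y(2) by (meson continuous_on_eq_continuous_within has_vector_derivative_continuous)
  then obtain r where r: "r > 0" "\<And>t. t \<in> {0..d} \<Longrightarrow> dist t 0 < r \<Longrightarrow> dist (y t) (y 0) < m"
    unfolding continuous_on_iff using m(1) d(1) by (metis atLeastAtMost_iff less_eq_real_def)
  define e where "e = min d (r / 2)"
  have e: "0 < e" "e \<le> d" "e < r" using d r by (auto simp: e_def)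
  have in_box: "y t \<in> cbox lo hi" if "t \<in> {0..e}" for t
  proof -
    have "dist (y t) x0 < m" using r(2)[of t] that e y(1) by (simp add: dist_real_def)
    then have "\<bar>y t $ i - x0 $ i\<bar> \<le> m" for i
      using dist_vec_nth_le[of "y t" i x0] by (simp add: dist_real_def)
    then show ?thesis unfolding box by blast
  qed
  have "(y has_vector_derivative vfield a (y t)) (at t within {0..e})" if "t \<in> {0..e}" for t
    using y(2)[of t] that e in_box[OF that]
    by (auto simp: F_def intro: has_vector_derivative_within_subset)
  then show ?thesis
    using e(1) y(1) in_box in_phase by (intro exI[of _ e]) blast
qed

section \<open>Gluing of solutions and maximal continuation\<close>

lemma time_interval_closed_subset: "t \<in> time_interval T \<Longrightarrow> 0 \<le> s \<Longrightarrow> {s..t} \<subseteq> time_interval T"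
  unfolding time_interval_def using ereal_less_le le_less_trans by fastforce

lemma time_interval_ereal: "time_interval (ereal b) = {0..<b}"
  by (auto simp: time_interval_def)

text \<open>The shorter interval is relatively open in the longer one, so derivatives within the two
  agree. This transfers the equation to the union of a chain of solutions.\<close>

lemma at_within_time_interval:
  assumes "t \<in> time_interval T" "T \<le> T'"
  shows "at t within time_interval T' = at t within time_interval T"
proof (rule at_within_nhd)
  show "t \<in> {s. ereal s < T}" using assms by (simp add: time_interval_def)
  show "open {s. ereal s < T}"
    by (cases T) (auto simp: lessThan_def[symmetric])
  show "time_interval T' \<inter> {s. ereal s < T} - {t} = time_interval T \<inter> {s. ereal s < T} - {t}"
    using assms by (auto simp: time_interval_def)
qed

lemma solution_cong:
  assumes "solution a T x" "\<And>t. t \<in> time_interval T \<Longrightarrow> y t = x t"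
  shows "solution a T y"
  using assms unfolding solution_def
  by (metis has_vector_derivative_transform)

lemma solution_continuous_on: "solution a T x \<Longrightarrow> continuous_on (time_interval T) x"
  unfolding solution_def
  by (meson continuous_on_eq_continuous_within has_vector_derivative_continuous)

lemma solution_integral:
  assumes "solution a T x" "t \<in> time_interval T"
  shows "x t = x 0 + integral {0..t} (\<lambda>s. vfield a (x s))"
proof -
  have t: "0 \<le> t" using assms(2) by (simp add: time_interval_def)
  have "((\<lambda>s. vfield a (x s)) has_integral x t - x 0) {0..t}"
    using assms(1) time_interval_closed_subset[OF assms(2) order_refl] unfolding solution_def
    by (intro fundamental_theorem_of_calculus t) (meson has_vector_derivative_within_subset subsetD)
  then show ?thesis by (simp add: integral_unique)
qed

text \<open>Zorn's lemma on the graphs of solutions with the given initial value. Members of a chain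
  agree wherever both are defined, so their union is again the graph of a solution.\<close>

lemma maximal_trajectory:
  assumes "solution a T0 x0" "0 < T0"
  shows "\<exists>T x. trajectory a T x \<and> x 0 = x0 0"
proof -
  define gr where "gr T x = (\<lambda>t. (t, x t)) ` time_interval T" for T and x :: "real \<Rightarrow> real ^ 3"
  define \<A> where "\<A> = {gr T x | T x. 0 < T \<and> solution a T x \<and> x 0 = x0 0}"
  have zero: "0 \<in> time_interval T" if "0 < T" for T
    using that by (simp add: time_interval_def zero_ereal_def[symmetric])
  have "\<exists>M\<in>\<A>. \<forall>X\<in>\<A>. M \<subseteq> X \<longrightarrow> X = M"
  proof (rule subset_Zorn_nonempty)
    show "\<A> \<noteq> {}" using assms unfolding \<A>_def by blast
    fix \<C> assume ne: "\<C> \<noteq> {}" and ch: "subset.chain \<A> \<C>"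
    define \<P> where "\<P> = {(T, x). gr T x \<in> \<C> \<and> 0 < T \<and> solution a T x \<and> x 0 = x0 0}"
    have \<C>: "\<C> = (\<lambda>(T, x). gr T x) ` \<P>"
      using ch unfolding subset.chain_def \<P>_def \<A>_def by (fastforce simp: image_iff)
    have agree: "x t = y t"
      if "(T, x) \<in> \<P>" "(T', y) \<in> \<P>" "t \<in> time_interval T" "t \<in> time_interval T'" for T x T' y t
    proof -
      have "gr T x \<in> \<C>" "gr T' y \<in> \<C>" using that by (auto simp: \<P>_def)
      then have "gr T x \<subseteq> gr T' y \<or> gr T' y \<subseteq> gr T x"
        using ch unfolding subset.chain_def by blast
      moreover have "(t, x t) \<in> gr T x" "(t, y t) \<in> gr T' y"
        using that(3,4) unfolding gr_def by auto
      moreover have "u = x t" if "(t, u) \<in> gr T x" for u using that unfolding gr_def by auto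
      moreover have "u = y t" if "(t, u) \<in> gr T' y" for u using that unfolding gr_def by auto
      ultimately show ?thesis by (metis subsetD)
    qed
    define T where "T = (SUP (T, x)\<in>\<P>. T)"
    define z where "z t = (SOME u. \<exists>(T, x)\<in>\<P>. t \<in> time_interval T \<and> u = x t)" for t
    have z: "z t = x t" if "(T', x) \<in> \<P>" "t \<in> time_interval T'" for T' x t
    proof -
      have "\<exists>(T, x)\<in>\<P>. t \<in> time_interval T \<and> z t = x t"
        unfolding z_def by (rule someI2[of _ "x t"]) (use that in auto)
      then obtain T'' x'' where "(T'', x'') \<in> \<P>" "t \<in> time_interval T''" "z t = x'' t" by auto
      then show ?thesis using agree[of T'' x'' T' x t] that by simp
    qed
    have upper: "T' \<le> T" if "(T', x) \<in> \<P>" for T' x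
      unfolding T_def using that by (intro SUP_upper2[of "(T', x)"]) auto
    have cover: "\<exists>(T', x)\<in>\<P>. t \<in> time_interval T'" if "t \<in> time_interval T" for t
      using that unfolding time_interval_def T_def by (auto simp: less_SUP_iff)
    have "\<Union>\<C> = gr T z"
    proof
      show "\<Union>\<C> \<subseteq> gr T z"
      proof
        fix p assume "p \<in> \<Union>\<C>"
        then obtain T' x t where *: "(T', x) \<in> \<P>" "t \<in> time_interval T'" "p = (t, x t)"
          unfolding \<C> gr_def by auto
        then have "t \<in> time_interval T" using upper[OF *(1)] by (auto simp: time_interval_def)
        then show "p \<in> gr T z" unfolding gr_def using z[OF *(1,2)] *(3) by auto
      qed
      show "gr T z \<subseteq> \<Union>\<C>"
      proof
        fix p assume "p \<in> gr T z"
        then obtain t where t: "t \<in> time_interval T" "p = (t, z t)" unfolding gr_def by auto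
        obtain T' x where *: "(T', x) \<in> \<P>" "t \<in> time_interval T'" using cover[OF t(1)] by auto
        then show "p \<in> \<Union>\<C>" unfolding \<C> gr_def using z[OF *] t by force
      qed
    qed
    moreover have "solution a T z"
      unfolding solution_def
    proof
      fix t assume "t \<in> time_interval T"
      then obtain T' x where *: "(T', x) \<in> \<P>" "t \<in> time_interval T'" using cover by blast
      have "solution a T' z"
        using z[OF *(1)] * by (intro solution_cong[of a T' x z]) (auto simp: \<P>_def)
      then show "z t \<in> phase \<and>
          (z has_vector_derivative vfield a (z t)) (at t within time_interval T)"
        using at_within_time_interval[OF *(2) upper[OF *(1)]] *(2) by (simp add: solution_def)
    qed
    moreover obtain T' x where Tx: "(T', x) \<in> \<P>" using ne unfolding \<C> by auto
    then have "0 < T" "z 0 = x0 0"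
      using upper[OF Tx] z[OF Tx zero] by (auto simp: \<P>_def)
    ultimately show "\<Union>\<C> \<in> \<A>" unfolding \<A>_def by blast
  qed
  then obtain M where M: "M \<in> \<A>" "\<And>X. X \<in> \<A> \<Longrightarrow> M \<subseteq> X \<Longrightarrow> X = M" by auto
  obtain T x where T: "0 < T" "solution a T x" "x 0 = x0 0"
    and max: "\<And>X. X \<in> \<A> \<Longrightarrow> gr T x \<subseteq> X \<Longrightarrow> X = gr T x"
  proof -
    from M(1) obtain T x where "M = gr T x" "0 < T" "solution a T x" "x 0 = x0 0"
      unfolding \<A>_def by auto
    then show thesis using M(2) by (intro that[of T x]) auto
  qed
  have "\<not> (T < T' \<and> solution a T' y \<and> (\<forall>t\<in>time_interval T. y t = x t))" for T' y
  proof
    assume *: "T < T' \<and> solution a T' y \<and> (\<forall>t\<in>time_interval T. y t = x t)"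
    obtain b where b: "T = ereal b" using T(1) * by (cases T) auto
    have "gr T x \<subseteq> gr T' y" using * unfolding gr_def time_interval_def by force
    moreover have "gr T' y \<in> \<A>"
      using T * zero[OF T(1)] less_trans[OF T(1)] unfolding \<A>_def
      by (auto intro!: exI[of _ T'] exI[of _ y])
    ultimately have "gr T' y = gr T x" by (intro max)
    \<comment> \<open>Only the longer interval contains the right endpoint \<open>b\<close>.\<close>
    moreover have "(b, y b) \<in> gr T' y" "(b, y b) \<notin> gr T x"
      using T(1) * b unfolding gr_def time_interval_def by auto
    ultimately show False by blast
  qed
  then show ?thesis using T unfolding trajectory_def by blast
qed

lemma trajectory_exists:
  assumes "x0 \<in> phase"
  shows "\<exists>T x. trajectory a T x \<and> x 0 = x0"
proof -
  obtain e y where y: "0 < e" "y 0 = x0"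
    "\<And>t. t \<in> {0..e} \<Longrightarrow> y t \<in> phase \<and> (y has_vector_derivative vfield a (y t)) (at t within {0..e})"
    using local_solution[OF assms] by metis
  then have "solution a (ereal e) y"
    unfolding solution_def time_interval_ereal
    by (auto intro: has_vector_derivative_within_subset[where S = "{0..e}"])
  then show ?thesis using maximal_trajectory y by fastforce
qed

text \<open>The blow-up alternative: the field is bounded on the box, so a solution on a finite interval
  has a limit at the right endpoint, from which it can be continued.\<close>

lemma trajectory_in_box_global:
  assumes tr: "trajectory a T x" and "0 < m"
    and box: "\<And>t i. t \<in> time_interval T \<Longrightarrow> m \<le> x t $ i \<and> x t $ i \<le> M"
  shows "T = \<infinity>"
proof (rule ccontr)
  assume "T \<noteq> \<infinity>"
  have sol: "solution a T x" and "0 < T" using tr by (auto simp: trajectory_def)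
  then obtain b where T: "T = ereal b" and b: "0 < b" using \<open>T \<noteq> \<infinity>\<close> by (cases T) auto
  have J: "time_interval T = {0..<b}" unfolding T by (rule time_interval_ereal)
  define K where "K = (cbox (\<chi> i. m) (\<chi> i. M) :: (real ^ 3) set)"
  have K: "compact K" "K \<subseteq> phase" and xK: "\<And>t. t \<in> {0..<b} \<Longrightarrow> x t \<in> K"
    using box J \<open>0 < m\<close> unfolding K_def phase_def
    by (auto simp: mem_box_cart intro: less_le_trans compact_cbox)
  have "compact (vfield a ` K)"
    using compact_continuous_image[OF vfield_continuous_on] K by blast
  then obtain B where B: "\<And>u. u \<in> K \<Longrightarrow> norm (vfield a u) \<le> B"
    using compact_imp_bounded bounded_iff by (metis imageI)
  have "0 \<in> {0..<b}" using b by simp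
  then have B0: "0 \<le> B" using B[OF xK] norm_ge_zero order_trans by blast
  \<comment> \<open>The field is bounded on the compact box, so \<open>x\<close> is Lipschitz and
    extends continuously to \<open>b\<close>.\<close>
  have "B-lipschitz_on {0..<b} x"
  proof (rule bounded_derivative_imp_lipschitz)
    show "(x has_derivative (\<lambda>h. h *\<^sub>R vfield a (x t))) (at t within {0..<b})" if "t \<in> {0..<b}" for t
      using sol that unfolding solution_def J has_vector_derivative_def by blast
    show "onorm (\<lambda>h. h *\<^sub>R vfield a (x t)) \<le> B" if "t \<in> {0..<b}" for t
      using B[OF xK[OF that]] by (intro onorm_bound B0) (simp add: mult.commute[of B] mult_left_mono)
  qed (use B0 in auto)
  then obtain y where y: "B-lipschitz_on (closure {0..<b}) y" "\<And>t. t \<in> {0..<b} \<Longrightarrow> y t = x t"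
    using lipschitz_extend_closure by metis
  have yc: "continuous_on {0..b} y"
    using lipschitz_on_continuous_on[OF y(1)] b by simp
  have yK: "y t \<in> K" if "t \<in> {0..b}" for t
  proof -
    have "y ` closure {0..<b} \<subseteq> K"
      using yc b y(2) xK K(1) by (intro image_closure_subset) (auto simp: compact_imp_closed)
    then show ?thesis using that b by auto
  qed
  have "y b \<in> phase" using yK[of b] b K(2) by auto
  then obtain e w where e: "0 < e" and w0: "w 0 = y b" and w: "\<And>t. t \<in> {0..e} \<Longrightarrow> w t \<in> phase \<and>
    (w has_vector_derivative vfield a (w t)) (at t within {0..e})"
    using local_solution by metis
  define z where "z t = (if t \<le> b then y t else w (t - b))" for t
  have w_shift: "((\<lambda>t. w (t - b)) has_vector_derivative vfield a (w (t - b))) (at t within {b..b + e})"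
    if "t \<in> {b..b + e}" for t
  proof -
    have "((w \<circ> (\<lambda>t. t - b)) has_vector_derivative 1 *\<^sub>R vfield a (w (t - b))) (at t within {b..b + e})"
    proof (rule vector_diff_chain_within)
      show "((\<lambda>t. t - b) has_vector_derivative 1) (at t within {b..b + e})"
        by (auto intro!: derivative_eq_intros)
      have "(\<lambda>t. t - b) ` {b..b + e} = {0..e}"
        by (auto simp: image_iff intro!: bexI[of _ "_ + b"])
      then show "(w has_vector_derivative vfield a (w (t - b))) (at (t - b) within (\<lambda>t. t - b) ` {b..b + e})"
        using w[of "t - b"] that by simp
    qed
    then show ?thesis by (simp add: o_def)
  qed
  have wc: "continuous_on {b..b + e} (\<lambda>t. w (t - b))"
    using w_shift by (meson continuous_on_eq_continuous_within has_vector_derivative_continuous)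
  have "continuous_on ({0..b} \<union> {b..b + e}) z"
    unfolding z_def using yc wc w0 by (intro continuous_on_If) auto
  then have zc: "continuous_on {0..b + e} z"
    using b e by (simp add: ivl_disj_un_two_touch)
  have zph: "z t \<in> phase" if "t \<in> {0..b + e}" for t
    using yK[of t] w[of "t - b"] that K(2) by (auto simp: z_def)
  have fz: "continuous_on {0..b + e} (\<lambda>t. vfield a (z t))"
    using continuous_on_compose2[OF vfield_continuous_on[OF order_refl] zc] zph by blast
  \<comment> \<open>Integral equations are glued instead of one-sided derivatives at
    \<open>b\<close>; differentiating once at the end gives the equation on the whole interval. At
    \<open>b\<close> itself the identity holds because both sides are continuous.\<close>
  have before: "z t = z 0 + integral {0..t} (\<lambda>s. vfield a (z s))" if "t \<in> {0..b}" for t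
  proof -
    have "continuous_on {0..b} (\<lambda>t. z t - integral {0..t} (\<lambda>s. vfield a (z s)))"
      using e by (intro continuous_intros indefinite_integral_continuous_1 integrable_continuous_real
        continuous_on_subset[OF fz] continuous_on_subset[OF zc]) auto
    then have "closed {t \<in> {0..b}. z t - integral {0..t} (\<lambda>s. vfield a (z s)) = z 0}"
      by (rule continuous_closed_preimage_constant) simp
    then have closed: "closed {t \<in> {0..b}. z t = z 0 + integral {0..t} (\<lambda>s. vfield a (z s))}"
      by (simp add: diff_eq_eq)
    have "z t = z 0 + integral {0..t} (\<lambda>s. vfield a (z s))" if "t \<in> {0..<b}" for t
    proof -
      have zx: "z s = x s" if "s \<in> {0..<b}" for s using that y(2) by (simp add: z_def)
      have "integral {0..t} (\<lambda>s. vfield a (z s)) = integral {0..t} (\<lambda>s. vfield a (x s))"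
        using that zx by (intro Henstock_Kurzweil_Integration.integral_cong) simp
      then show ?thesis using solution_integral[OF sol, of t] that zx b J by simp
    qed
    then have "{0..<b} \<subseteq> {t \<in> {0..b}. z t = z 0 + integral {0..t} (\<lambda>s. vfield a (z s))}"
      using atLeastLessThan_subseteq_atLeastAtMost_iff[of 0 b 0 b] by blast
    then have "closure {0..<b} \<subseteq> {t \<in> {0..b}. z t = z 0 + integral {0..t} (\<lambda>s. vfield a (z s))}"
      using closed by (rule closure_minimal)
    moreover have "closure {0..<b} = {0..b}" using b by simp
    ultimately show ?thesis using \<open>t \<in> {0..b}\<close> by blast
  qed
  have after: "z t = z b + integral {b..t} (\<lambda>s. vfield a (z s))" if "t \<in> {b..b + e}" for t
  proof -
    have zw: "z s = w (s - b)" if "s \<in> {b..b + e}" for s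
      using that w0 by (auto simp: z_def)
    have "((\<lambda>s. vfield a (z s)) has_integral z t - z b) {b..t}"
    proof (intro fundamental_theorem_of_calculus)
      show "(z has_vector_derivative vfield a (z s)) (at s within {b..t})" if "s \<in> {b..t}" for s
        using w_shift[of s] zw that \<open>t \<in> _\<close>
        by (intro has_vector_derivative_transform[OF that, of z "\<lambda>t. w (t - b)"])
           (auto intro: has_vector_derivative_within_subset)
    qed (use that in auto)
    then show ?thesis by (simp add: integral_unique)
  qed
  have z: "z t = z 0 + integral {0..t} (\<lambda>s. vfield a (z s))" if "t \<in> {0..b + e}" for t
  proof (cases "t \<le> b")
    case False
    then have split: "integral {0..t} (\<lambda>s. vfield a (z s))
        = integral {0..b} (\<lambda>s. vfield a (z s)) + integral {b..t} (\<lambda>s. vfield a (z s))"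
      using b that
      by (intro Henstock_Kurzweil_Integration.integral_combine[symmetric] integrable_continuous_real
        continuous_on_subset[OF fz]) auto
    have "z b = z 0 + integral {0..b} (\<lambda>s. vfield a (z s))"
      by (rule before) (use b in simp)
    moreover have "z t = z b + integral {b..t} (\<lambda>s. vfield a (z s))"
      by (rule after) (use that False in simp)
    ultimately show ?thesis unfolding split by (metis add.assoc)
  qed (rule before, use that in simp)
  have "solution a (ereal (b + e)) z"
    unfolding solution_def time_interval_ereal
  proof
    fix t assume t: "t \<in> {0..<b + e}"
    have "(z has_vector_derivative vfield a (z t)) (at t within {0..b + e})"
    proof (rule has_vector_derivative_transform[where f = "\<lambda>t. z 0 + integral {0..t} (\<lambda>s. vfield a (z s))"])
      show "((\<lambda>t. z 0 + integral {0..t} (\<lambda>s. vfield a (z s))) has_vector_derivative vfield a (z t))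
          (at t within {0..b + e})"
        using has_vector_derivative_add[OF has_vector_derivative_const
          integral_has_vector_derivative[OF fz, of t], of "z 0"] t by simp
      show "z s = z 0 + integral {0..s} (\<lambda>r. vfield a (z r))" if "s \<in> {0..b + e}" for s
        by (rule z[OF that])
    qed (use t in simp)
    then show "z t \<in> phase \<and> (z has_vector_derivative vfield a (z t)) (at t within {0..<b + e})"
      using t zph by (auto intro: has_vector_derivative_within_subset[where S = "{0..b + e}"])
  qed
  moreover have "T < ereal (b + e)" using T e by simp
  moreover have "\<forall>t\<in>time_interval T. z t = x t" using y(2) unfolding J z_def by auto
  ultimately show False using tr unfolding trajectory_def by blast
qed

section \<open>The region bounded by the three surfaces\<close>

text \<open>A scalar form free of index arithmetic and symmetric in the last two arguments, so that
  one computation serves all six orderings of the coordinates.\<close>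

definition vfield3 :: "real \<Rightarrow> real \<Rightarrow> real \<Rightarrow> real \<Rightarrow> real" where
  "vfield3 a x y z = x / y + x / z - 2 * a * ((2 * x\<^sup>2 - y\<^sup>2 - z\<^sup>2) / (y * z)) - 2"

definition gam3 :: "real \<Rightarrow> real \<Rightarrow> real \<Rightarrow> real" where
  "gam3 x y z = (y - z)\<^sup>2 + 2 * x * (y + z) - 3 * x\<^sup>2"

lemma index3_cases:
  fixes i j k :: 3
  assumes "{i, j, k} = UNIV"
  shows "(j = i + 1 \<and> k = i + 2) \<or> (j = i + 2 \<and> k = i + 1)" "i \<noteq> j" "i \<noteq> k" "j \<noteq> k"
proof -
  have "card {i, j, k} = 3" using assms by simp
  then show ne: "i \<noteq> j" "i \<noteq> k" "j \<noteq> k" by (auto simp: card_insert_if split: if_splits)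
  have "j \<in> {i, i + 1, i + 2}" "k \<in> {i, i + 1, i + 2}" using UNIV_3_shift[of i] by blast+
  then show "(j = i + 1 \<and> k = i + 2) \<or> (j = i + 2 \<and> k = i + 1)" using ne by auto
qed

lemma vfield_nth: "{i, j, k} = UNIV \<Longrightarrow> vfield a x $ i = vfield3 a (x $ i) (x $ j) (x $ k)"
  using index3_cases(1)[of i j k] by (auto simp: vfield_def vfield3_def algebra_simps)

lemma gam_eq_gam3: "{i, j, k} = UNIV \<Longrightarrow> gam i x = gam3 (x $ i) (x $ j) (x $ k)"
  using index3_cases(1)[of i j k] by (auto simp: gam_def gam3_def algebra_simps power2_eq_square)

lemma all_index3: "{i, j, k} = (UNIV :: 3 set) \<Longrightarrow> (\<forall>l. P l) \<longleftrightarrow> P i \<and> P j \<and> P k"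
  by (metis UNIV_I insert_iff singletonD)

lemma sorted_index3:
  fixes u :: "real ^ 3"
  obtains i j k where "{i, j, k} = UNIV" "u $ k \<le> u $ j" "u $ j \<le> u $ i"
proof -
  have U: "{1, 2, 3} = (UNIV :: 3 set)" using UNIV_3 by simp
  then have "{1, 3, 2} = (UNIV :: 3 set)" "{2, 1, 3} = (UNIV :: 3 set)" "{2, 3, 1} = (UNIV :: 3 set)"
    "{3, 1, 2} = (UNIV :: 3 set)" "{3, 2, 1} = (UNIV :: 3 set)" by (auto simp: insert_commute)
  with U show thesis using that by (metis linear)
qed

text \<open>Completing the square leaves \<open>4 * (y - x) * x\<close>, which is nonnegative as
  soon as some coordinate is at least \<open>x\<close>; for \<open>y = x\<close> the square itself
  is \<open>z\<^sup>2\<close>.\<close>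

lemma gam3_pos:
  assumes "0 < x" "0 < z" "x \<le> y"
  shows "0 < gam3 x y z" "0 < gam3 x z y"
proof -
  have "gam3 x y z = (z - (y - x))\<^sup>2 + 4 * (y - x) * x"
    by (simp add: gam3_def power2_eq_square algebra_simps)
  moreover have "0 < (z - (y - x))\<^sup>2 + 4 * (y - x) * x"
  proof (cases "y = x")
    case False
    then show ?thesis using assms by (intro add_nonneg_pos) auto
  qed (use assms in simp)
  ultimately show "0 < gam3 x y z" by simp
  then show "0 < gam3 x z y" by (simp add: gam3_def power2_commute algebra_simps)
qed

lemma gam3_nonpos_imp_max:
  assumes "0 < x" "0 < y" "0 < z" "gam3 x y z \<le> 0"
  shows "y < x" "z < x"
  using gam3_pos[of x z y] gam3_pos[of x y z] assms by (force simp: not_le[symmetric])+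

text \<open>A product of Heron type. By \<open>sqrt_diff_bound\<close> the second factor is positive
  in the sorted case, so the surface has the equation
  \<open>sqrt (x - y) + sqrt (x - z) = sqrt x\<close>.\<close>

lemma gam3_factor:
  assumes "y \<le> x" "z \<le> x"
  shows "gam3 x y z = (x - (sqrt (x - y) + sqrt (x - z))\<^sup>2) * (x - (sqrt (x - y) - sqrt (x - z))\<^sup>2)"
proof -
  define \<alpha> \<beta> where "\<alpha> = sqrt (x - y)" and "\<beta> = sqrt (x - z)"
  have y: "y = x - \<alpha>\<^sup>2" and z: "z = x - \<beta>\<^sup>2" using assms by (simp_all add: \<alpha>_def \<beta>_def)
  have "gam3 x y z = (x - (\<alpha> + \<beta>)\<^sup>2) * (x - (\<alpha> - \<beta>)\<^sup>2)"
    unfolding gam3_def y z by algebra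
  then show ?thesis unfolding \<alpha>_def \<beta>_def .
qed

lemma sqrt_diff_bound:
  assumes "0 < z" "z \<le> y" "y \<le> x"
  shows "0 < x - (sqrt (x - y) - sqrt (x - z))\<^sup>2"
proof -
  have "(sqrt (x - z) - sqrt (x - y))\<^sup>2 \<le> (sqrt (x - z))\<^sup>2"
    using assms by (intro power_mono) auto
  then show ?thesis using assms by (simp add: power2_commute)
qed

lemma gam3_nonneg_sqrt:
  assumes "0 < z" "z \<le> y" "y \<le> x" "0 \<le> gam3 x y z"
  shows "(sqrt (x - y) + sqrt (x - z))\<^sup>2 \<le> x"
  using assms gam3_factor[of y x z] sqrt_diff_bound[of z y x] by (auto simp: zero_le_mult_iff)

text \<open>In units with x = 1:
  \<open>sqrt (1 - y) \<le> 1 - sqrt (1 - z) \<le> 1 - (1 - z) = z\<close>. This bounds the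
  functional from above inside the region.\<close>

lemma gam3_nonneg_imp:
  assumes "0 < z" "z \<le> y" "y \<le> x" "0 \<le> gam3 x y z"
  shows "x * (x - y) \<le> z\<^sup>2"
proof (rule ccontr)
  assume *: "\<not> x * (x - y) \<le> z\<^sup>2"
  have x: "0 < x" using assms by simp
  \<comment> \<open>Division with remainder by \<open>x * (x - y) - z\<^sup>2\<close> in the
    variable \<open>y\<close>; the remainder is nonpositive because
    \<open>z \<le> x\<close>.\<close>
  have "x\<^sup>2 * gam3 x y z = (x * (x - y) - z\<^sup>2) * (x * (2 * z - y - 3 * x) + z\<^sup>2)
      + z\<^sup>2 * (z + 3 * x) * (z - x)"
    by (simp add: gam3_def power2_eq_square algebra_simps)
  also have "\<dots> \<le> (x * (x - y) - z\<^sup>2) * (x * (2 * z - y - 3 * x) + z\<^sup>2)"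
    using assms by (simp add: mult_nonneg_nonpos)
  also have "\<dots> < 0"
  proof (rule mult_pos_neg)
    have "z\<^sup>2 \<le> x * x" using assms by (simp add: power2_eq_square mult_mono)
    moreover have "x * (2 * z - y - 3 * x) \<le> x * (- 2 * x)" using assms x by (intro mult_left_mono) auto
    moreover have "0 < x * x" using x by simp
    ultimately show "x * (2 * z - y - 3 * x) + z\<^sup>2 < 0" by (simp add: algebra_simps)
  qed (use * in simp)
  finally show False using assms x by (simp add: mult_less_0_iff)
qed

text \<open>In units with x = 1 put \<alpha> = \<open>sqrt (1 - y)\<close> and \<beta> =
  \<open>sqrt (1 - z)\<close>. Now \<alpha> + \<beta> \<ge> 1 and \<alpha> \<le> \<beta> < 1, whence
  \<beta> \<ge> 1/2 and z = (1 - \<beta>) (1 + \<beta>) \<le> 2 \<alpha>. These bounds keep the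
  functional bounded below outside the region.\<close>

lemma gam3_nonpos_imp:
  assumes "0 < z" "z \<le> y" "y \<le> x" "gam3 x y z \<le> 0"
  shows "z\<^sup>2 \<le> 4 * (x * (x - y))" "x \<le> 4 * (x - z)"
proof -
  have x: "0 < x" using assms by simp
  have gam3: "gam3 x y z = (y - z)\<^sup>2 + x * (2 * y + 2 * z - 3 * x)"
    by (simp add: gam3_def power2_eq_square algebra_simps)
  show "x \<le> 4 * (x - z)"
  proof (rule ccontr)
    assume "\<not> x \<le> 4 * (x - z)"
    then have "0 < x * (2 * y + 2 * z - 3 * x)" using x assms by (intro mult_pos_pos) auto
    then show False using gam3 assms(4) zero_le_power2[of "y - z"] by linarith
  qed
  show "z\<^sup>2 \<le> 4 * (x * (x - y))"
  proof (rule ccontr)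
    assume *: "\<not> z\<^sup>2 \<le> 4 * (x * (x - y))"
    have "16 * x\<^sup>2 * gam3 x y z = (z\<^sup>2 - 4 * (x * (x - y))) * (4 * x * (3 * x + y - 2 * z) - z\<^sup>2)
        + z\<^sup>2 * (z\<^sup>2 + 8 * x * z)"
      by (simp add: gam3_def power2_eq_square algebra_simps)
    moreover have "0 < (z\<^sup>2 - 4 * (x * (x - y))) * (4 * x * (3 * x + y - 2 * z) - z\<^sup>2)"
    proof (rule mult_pos_pos)
      have "z\<^sup>2 \<le> x * x" using assms by (simp add: power2_eq_square mult_mono)
      moreover have "4 * x * (2 * x) \<le> 4 * x * (3 * x + y - 2 * z)"
        using assms x by (intro mult_left_mono) auto
      moreover have "0 < x * x" using x by simp
      ultimately show "0 < 4 * x * (3 * x + y - 2 * z) - z\<^sup>2" by (simp add: algebra_simps)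
    qed (use * in simp)
    moreover have "0 \<le> z\<^sup>2 * (z\<^sup>2 + 8 * x * z)" using assms x by simp
    ultimately have "0 < 16 * x\<^sup>2 * gam3 x y z" by linarith
    then show False using x assms(4) by (simp add: zero_less_mult_iff)
  qed
qed

lemma vfield3_polynomial:
  assumes "x \<noteq> 0" "y \<noteq> 0" "z \<noteq> 0"
  shows "vfield3 a x y z = (x\<^sup>2 * (y + z) - 2 * a * x * (2 * x\<^sup>2 - y\<^sup>2 - z\<^sup>2) - 2 * x * y * z) / (x * y * z)"
  using assms by (simp add: vfield3_def field_simps power2_eq_square)

definition diff_rate :: "real \<Rightarrow> real \<Rightarrow> real \<Rightarrow> real \<Rightarrow> real" where
  "diff_rate a x y z = (x * y + x * z + y * z - 2 * a * (2 * x\<^sup>2 + 3 * x * y + 2 * y\<^sup>2 - z\<^sup>2)) / (x * y * z)"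

lemma vfield3_diff:
  assumes "x \<noteq> 0" "y \<noteq> 0" "z \<noteq> 0"
  shows "vfield3 a x y z - vfield3 a y x z = diff_rate a x y z * (x - y)"
  using assms by (simp add: vfield3_def diff_rate_def field_simps power2_eq_square)

text \<open>The inhomogeneous part of the equation for \<open>gam3\<close> is only determined modulo \<open>gam3\<close>. This
  choice, with \<open>2 \<surd>(x - y) \<surd>(x - z)\<close> in place of \<open>x - (x - y) - (x - z)\<close> (they agree where
  \<open>gam3\<close> vanishes), has a definite sign off the surface as well.\<close>

definition Psi :: "real \<Rightarrow> real \<Rightarrow> real \<Rightarrow> real \<Rightarrow> real" where
  "Psi a x y z = 2 * (26 * a - 5) * sqrt (x - y) * sqrt (x - z)
     - (4 - 16 * a) * ((x - y) + (x - z))"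

text \<open>The term with the denominator is the price of the replacement made in
  \<open>Psi\<close>: the two expressions differ by \<open>gam3 x y z\<close> divided by this
  denominator, which \<open>sqrt_diff_bound\<close> keeps positive.\<close>

definition gam3_rate :: "real \<Rightarrow> real \<Rightarrow> real \<Rightarrow> real \<Rightarrow> real" where
  "gam3_rate a x y z = (- 8 * a * (y\<^sup>2 + z\<^sup>2) + (2 - 12 * a) * y * z + (2 + 12 * a) * x * (y + z)
     + (4 * a - 6) * x\<^sup>2 + 6 * x * (x - y) * (x - z) * (26 * a - 5)
       / (x - (sqrt (x - y) - sqrt (x - z))\<^sup>2)) / (x * y * z)"

text \<open>Here \<open>p\<close>, \<open>q\<close>, \<open>r\<close> are the components of the
  field multiplied by \<open>x * y * z\<close>. Modulo \<open>gam3\<close> the derivative of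
  \<open>gam3\<close> is divisible by \<open>(x - y) * (x - z)\<close>, and the remaining factor is
  linear in the two differences and in \<open>x\<close>.\<close>

lemma gam3_derivative_polynomial:
  fixes x y z a p q r :: real
  assumes "p = x\<^sup>2 * (y + z) - 2 * a * x * (2 * x\<^sup>2 - y\<^sup>2 - z\<^sup>2) - 2 * x * y * z"
    "q = y\<^sup>2 * (x + z) - 2 * a * y * (2 * y\<^sup>2 - x\<^sup>2 - z\<^sup>2) - 2 * y * x * z"
    "r = z\<^sup>2 * (x + y) - 2 * a * z * (2 * z\<^sup>2 - x\<^sup>2 - y\<^sup>2) - 2 * z * x * y"
  shows "2 * (y - z) * (q - r) + 2 * p * (y + z) + 2 * x * (q + r) - 6 * x * p
    = (- 8 * a * (y\<^sup>2 + z\<^sup>2) + (2 - 12 * a) * y * z + (2 + 12 * a) * x * (y + z)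
     + (4 * a - 6) * x\<^sup>2) * gam3 x y z
     + 6 * x * (x - y) * (x - z) * ((26 * a - 5) * (x - (x - y) - (x - z))
         - (4 - 16 * a) * ((x - y) + (x - z)))"
  unfolding assms gam3_def by algebra

lemma gam3_derivative:
  assumes "0 < z" "z \<le> y" "y \<le> x"
  shows "2 * (y - z) * (vfield3 a y x z - vfield3 a z x y) + 2 * vfield3 a x y z * (y + z)
      + 2 * x * (vfield3 a y x z + vfield3 a z x y) - 6 * x * vfield3 a x y z
    = gam3_rate a x y z * gam3 x y z + 6 * x / (x * y * z) * ((x - y) * (x - z) * Psi a x y z)"
    (is "?L = ?R")
proof -
  define p q r where p: "p = x\<^sup>2 * (y + z) - 2 * a * x * (2 * x\<^sup>2 - y\<^sup>2 - z\<^sup>2) - 2 * x * y * z"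
    and q: "q = y\<^sup>2 * (x + z) - 2 * a * y * (2 * y\<^sup>2 - x\<^sup>2 - z\<^sup>2) - 2 * y * x * z"
    and r: "r = z\<^sup>2 * (x + y) - 2 * a * z * (2 * z\<^sup>2 - x\<^sup>2 - y\<^sup>2) - 2 * z * x * y"
  define V where "V = x * y * z"
  have nz: "x \<noteq> 0" "y \<noteq> 0" "z \<noteq> 0" "V \<noteq> 0" using assms by (auto simp: V_def)
  have f: "vfield3 a x y z = p / V" "vfield3 a y x z = q / V" "vfield3 a z x y = r / V"
    using nz by (simp_all add: vfield3_polynomial p q r V_def mult_ac)
  define W where "W = x - (sqrt (x - y) - sqrt (x - z))\<^sup>2"
  have W: "W \<noteq> 0" using sqrt_diff_bound[OF assms] by (simp add: W_def)
  have sq: "(sqrt (x - y) + sqrt (x - z))\<^sup>2 = (x - y) + (x - z) + 2 * sqrt (x - y) * sqrt (x - z)"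
    using assms by (simp add: power2_sum)
  have split: "x - (x - y) - (x - z) = 2 * sqrt (x - y) * sqrt (x - z) + gam3 x y z / W"
    using gam3_factor[of y x z] assms W unfolding W_def[symmetric] by (simp add: sq)
  have field: "(e * g + u * (p * (s + g / W) - q)) / V = (e + u * p / W) / V * g + u / V * (p * s - q)"
    for e g u p s q :: real
    using W nz by (simp add: divide_simps) algebra
  have "?L = (2 * (y - z) * (q - r) + 2 * p * (y + z) + 2 * x * (q + r) - 6 * x * p) / V"
    unfolding f by (simp add: diff_divide_distrib add_divide_distrib algebra_simps)
  also have "\<dots> = ?R"
    unfolding gam3_derivative_polynomial[OF p q r] split gam3_rate_def W_def[symmetric] Psi_def
      V_def[symmetric] field by (simp only: divide_inverse) algebra
  finally show ?thesis .
qed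

section \<open>Closure and exterior of the region\<close>

lemma phase_closure_eq: "X \<subseteq> phase \<Longrightarrow> phase_closure X = phase \<inter> closure X"
  by (simp add: phase_closure_def closure_of_subtopology Int_absorb1)

lemma S_set_subset_phase: "S_set \<subseteq> phase" and phase_ext_subset_phase: "phase_ext X \<subseteq> phase"
  by (auto simp: S_set_def phase_ext_def)

lemma gam_continuous: "continuous_on A (gam i)"
  unfolding gam_def by (intro continuous_intros)

lemma closed_gam: "closed {x. 0 \<le> gam i x}"
  using gam_continuous[of UNIV i] by (intro closed_Collect_le continuous_intros) auto

text \<open>Only the surface of the largest coordinate can bound the region, and decreasing that
  coordinate leads into the interior.\<close>

lemma lowered_max_in_S:
  assumes x: "x \<in> phase" and max: "\<And>j. x $ j \<le> x $ i" and gam: "0 \<le> gam i x"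
  shows "\<forall>\<^sub>F \<epsilon> in at_right 0. x - axis i \<epsilon> \<in> S_set"
proof -
  have pos: "0 < x $ j" for j using x by (simp add: phase_def)
  obtain j k where ijk: "{i, j, k} = (UNIV :: 3 set)" using UNIV_3_shift by blast
  then have jik: "{j, i, k} = (UNIV :: 3 set)" and kij: "{k, i, j} = (UNIV :: 3 set)" by auto
  note ne = index3_cases[OF ijk]
  define u where "u \<epsilon> = x - axis i \<epsilon>" for \<epsilon>
  have u: "u \<epsilon> $ i = x $ i - \<epsilon>" "u \<epsilon> $ j = x $ j" "u \<epsilon> $ k = x $ k" for \<epsilon>
    using ne by (simp_all add: u_def axis_def)
  have gam_jk: "0 < gam j x" "0 < gam k x"
    unfolding gam_eq_gam3[OF jik] gam_eq_gam3[OF kij] using gam3_pos(1) pos max by auto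
  have lim: "((\<lambda>\<epsilon>. gam l (u \<epsilon>)) \<longlongrightarrow> gam l x) (at_right 0)" if "l \<in> {j, k}" for l
  proof -
    have lim: "((\<lambda>\<epsilon>. x $ i - \<epsilon>) \<longlongrightarrow> x $ i) (at_right 0)"
      by (auto intro!: tendsto_eq_intros)
    show ?thesis
      using that unfolding gam_eq_gam3[OF jik] gam_eq_gam3[OF kij] gam3_def u
      by (auto simp: gam_eq_gam3[OF jik] gam_eq_gam3[OF kij] gam3_def u intro!: tendsto_intros lim)
  qed
  have gjk: "\<forall>\<^sub>F \<epsilon> in at_right 0. 0 < gam j (u \<epsilon>)" "\<forall>\<^sub>F \<epsilon> in at_right 0. 0 < gam k (u \<epsilon>)"
    by (rule order_tendstoD(1)[OF lim gam_jk(1)] order_tendstoD(1)[OF lim gam_jk(2)]; simp)+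
  \<comment> \<open>The lowered point must avoid the diagonal, which is removed from
    \<open>S_set\<close>; it can lie there for at most one value of \<epsilon>.\<close>
  have sgap: "\<exists>d>0. \<forall>\<epsilon>. 0 < \<epsilon> \<and> \<epsilon> < d \<longrightarrow> \<not> (x $ j = x $ k \<and> x $ i - \<epsilon> = x $ j)"
    using max[of j] by (intro exI[of _ "if x $ i = x $ j then 1 else x $ i - x $ j"]) auto
  then obtain d where d: "d > 0"
    "\<And>\<epsilon>. 0 < \<epsilon> \<Longrightarrow> \<epsilon> < d \<Longrightarrow> \<not> (x $ j = x $ k \<and> x $ i - \<epsilon> = x $ j)" by blast
  define e where "e = min d (x $ i / 2)"
  have e: "0 < e" using d pos[of i] by (simp add: e_def)
  have "\<forall>\<^sub>F \<epsilon> in at_right 0. \<epsilon> \<in> {0<..<e}"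
    using eventually_at_right_real[OF e] by simp
  with gjk show ?thesis
  proof eventually_elim
    case (elim \<epsilon>)
    then have \<epsilon>: "0 < \<epsilon>" "\<epsilon> < d" "2 * \<epsilon> < x $ i" by (auto simp: e_def)
    \<comment> \<open>As coordinate \<open>i\<close> is the largest, the bracket is at least
      \<open>2 * x $ i - 3 * \<epsilon>\<close>, which is positive by the choice of
      \<open>e\<close>.\<close>
    have "gam i (u \<epsilon>) = gam i x + \<epsilon> * (6 * x $ i - 2 * (x $ j + x $ k) - 3 * \<epsilon>)"
      unfolding gam_eq_gam3[OF ijk] gam3_def u by (simp add: power2_eq_square algebra_simps)
    moreover have "0 < \<epsilon> * (6 * x $ i - 2 * (x $ j + x $ k) - 3 * \<epsilon>)"
      using \<epsilon> max[of j] max[of k] by (intro mult_pos_pos) auto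
    ultimately have "0 < gam i (u \<epsilon>)" using gam by linarith
    then have "\<forall>l. 0 < gam l (u \<epsilon>)" using elim all_index3[OF ijk] by auto
    moreover have "\<forall>l. 0 < u \<epsilon> $ l" unfolding all_index3[OF ijk] u using pos \<epsilon> by simp
    moreover have "u \<epsilon> \<noteq> vec r" for r
      using d(2)[OF \<epsilon>(1,2)] u[of \<epsilon>] by (metis vec_component)
    ultimately show ?case unfolding S_set_def phase_def u_def by blast
  qed
qed

lemma axis_tendsto:
  fixes x :: "real ^ 'a::finite"
  shows
  "((\<lambda>\<epsilon>. x - axis i \<epsilon>) \<longlongrightarrow> x) (at_right 0)" "((\<lambda>\<epsilon>. x + axis i \<epsilon>) \<longlongrightarrow> x) (at_right (0 :: real))"
proof -
  have "((\<lambda>\<epsilon>::real. axis i \<epsilon>) \<longlongrightarrow> 0) (at_right 0)"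
  proof (rule vec_tendstoI)
    show "((\<lambda>\<epsilon>. axis i \<epsilon> $ j) \<longlongrightarrow> (0 :: real ^ 'a) $ j) (at_right 0)" for j
      by (cases "j = i") (auto simp: axis_def)
  qed
  from tendsto_diff[OF tendsto_const this, of x] tendsto_add[OF tendsto_const this, of x]
  show "((\<lambda>\<epsilon>. x - axis i \<epsilon>) \<longlongrightarrow> x) (at_right 0)" "((\<lambda>\<epsilon>. x + axis i \<epsilon>) \<longlongrightarrow> x) (at_right (0 :: real))"
    by simp_all
qed

text \<open>The diagonal comes back here: lowering one coordinate moves its points into
  \<open>S_set\<close>.\<close>

lemma phase_closure_S: "phase_closure S_set = {x \<in> phase. \<forall>i. 0 \<le> gam i x}"
proof -
  have "closure S_set \<subseteq> (\<Inter>i. {x. 0 \<le> gam i x})"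
    by (intro closure_minimal closed_INT) (auto simp: closed_gam S_set_def less_imp_le)
  moreover have "x \<in> closure S_set" if x: "x \<in> phase" "\<forall>i. 0 \<le> gam i x" for x
  proof -
    obtain i j k where ijk: "{i, j, k} = UNIV" "x $ k \<le> x $ j" "x $ j \<le> x $ i"
      by (rule sorted_index3)
    then have "x $ l \<le> x $ i" for l using all_index3[OF ijk(1), of "\<lambda>l. x $ l \<le> x $ i"] by auto
    then have "\<forall>\<^sub>F \<epsilon> in at_right 0. x - axis i \<epsilon> \<in> S_set"
      using lowered_max_in_S x by blast
    then have "\<forall>\<^sub>F \<epsilon> in at_right 0. x - axis i \<epsilon> \<in> closure S_set"
      by (rule eventually_mono) (use closure_subset in blast)
    then show ?thesis
      by (intro Lim_in_closed_set[OF closed_closure _ _ axis_tendsto(1)]) simp_all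
  qed
  ultimately show ?thesis unfolding phase_closure_eq[OF S_set_subset_phase] by auto
qed

lemma phase_ext_S: "phase_ext S_set = {x \<in> phase. \<exists>i. gam i x < 0}"
  unfolding phase_ext_def phase_closure_S by (auto simp flip: not_le)

lemma closure_ext_imp_gam_nonpos:
  assumes "x \<in> phase_closure (phase_ext S_set)"
  shows "x \<in> phase" "\<exists>i. gam i x \<le> 0"
proof -
  have "closure (phase_ext S_set) \<subseteq> (\<Union>i. {x. gam i x \<le> 0})"
    unfolding phase_ext_S
    by (intro closure_minimal closed_UN ballI closed_Collect_le[OF gam_continuous continuous_on_const])
      (auto intro: less_imp_le)
  then show "x \<in> phase" "\<exists>i. gam i x \<le> 0"
    using assms phase_closure_eq[OF phase_ext_subset_phase, of S_set] by auto
qed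

text \<open>A vanishing \<open>gam i\<close> makes coordinate \<open>i\<close> the strict maximum,
  and raising it then makes \<open>gam i\<close> negative at once.\<close>

lemma gam_zero_in_closure_ext:
  assumes x: "x \<in> phase" and gam: "gam i x = 0"
  shows "x \<in> phase_closure (phase_ext S_set)"
proof -
  obtain j k where ijk: "{i, j, k} = (UNIV :: 3 set)" using UNIV_3_shift by blast
  note ne = index3_cases[OF ijk]
  have pos: "0 < x $ l" for l using x by (simp add: phase_def)
  have lt: "x $ j < x $ i" "x $ k < x $ i"
    using gam3_nonpos_imp_max[of "x $ i" "x $ j" "x $ k"] pos gam gam_eq_gam3[OF ijk] by auto
  have ext: "x + axis i \<epsilon> \<in> phase_ext S_set" if "0 < \<epsilon>" for \<epsilon>
  proof -
    have u: "(x + axis i \<epsilon>) $ i = x $ i + \<epsilon>" "(x + axis i \<epsilon>) $ j = x $ j" "(x + axis i \<epsilon>) $ k = x $ k"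
      using ne by (simp_all add: axis_def)
    have "gam i (x + axis i \<epsilon>) = gam i x - \<epsilon> * (6 * x $ i - 2 * (x $ j + x $ k) + 3 * \<epsilon>)"
      unfolding gam_eq_gam3[OF ijk] gam3_def u by (simp add: power2_eq_square algebra_simps)
    moreover have "0 < \<epsilon> * (6 * x $ i - 2 * (x $ j + x $ k) + 3 * \<epsilon>)"
      using that lt pos[of i] by (intro mult_pos_pos) auto
    moreover have "x + axis i \<epsilon> \<in> phase"
      unfolding phase_def using that pos by (auto simp: axis_def add_pos_nonneg)
    ultimately show ?thesis unfolding phase_ext_S using gam
      by (intro CollectI conjI exI[of _ i]) auto
  qed
  have "\<forall>\<^sub>F \<epsilon> in at_right 0. x + axis i \<epsilon> \<in> closure (phase_ext S_set)"
    by (rule eventually_mono[OF eventually_at_right_less]) (rule subsetD[OF closure_subset ext])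
  then have "x \<in> closure (phase_ext S_set)"
    by (intro Lim_in_closed_set[OF closed_closure _ _ axis_tendsto(2)]) simp_all
  then show ?thesis using x by (simp add: phase_closure_eq[OF phase_ext_subset_phase])
qed

section \<open>Dynamics\<close>

lemma has_real_derivative_within_mono:
  fixes f :: "real \<Rightarrow> real"
  assumes "s \<le> t" and f: "\<And>r. r \<in> {s..t} \<Longrightarrow> (f has_real_derivative f' r) (at r within {s..t})"
    and f': "\<And>r. r \<in> {s..t} \<Longrightarrow> 0 \<le> f' r"
  shows "f s \<le> f t"
proof (cases "s = t")
  case False
  have "\<exists>r\<in>{s<..<t}. f t - f s = f' r * (t - s)"
    using False assms(1) f
    by (intro mvt_simple[where f' = "\<lambda>r h. f' r * h"]) (auto simp: has_field_derivative_def)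
  then obtain r where r: "r \<in> {s<..<t}" "f t - f s = f' r * (t - s)" by blast
  then have "0 \<le> f t - f s" using f'[of r] assms(1) by (metis atLeastAtMost_iff diff_ge_0_iff_ge
    greaterThanLessThan_iff less_imp_le mult_nonneg_nonneg)
  then show ?thesis by simp
qed simp

lemma component_derivative:
  assumes "solution a T x" "t \<in> time_interval T" "{i, j, k} = UNIV"
  shows "((\<lambda>t. x t $ i) has_real_derivative vfield3 a (x t $ i) (x t $ j) (x t $ k))
    (at t within time_interval T)"
  unfolding vfield_nth[OF assms(3), symmetric] has_real_derivative_iff_has_vector_derivative
  using assms(1,2) bounded_linear.has_vector_derivative[OF bounded_linear_vec_nth]
  unfolding solution_def by blast

text \<open>Three times this quantity bounds the logarithmic derivative of each coordinate. It is
  symmetric, so a single growth condition controls all three.\<close>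

definition load :: "real \<Rightarrow> real \<Rightarrow> real \<Rightarrow> real" where
  "load x y z = (x\<^sup>2 + y\<^sup>2 + z\<^sup>2) / (x * y * z)"

lemma load_commute: "load x y z = load y x z" "load x y z = load z x y"
  by (simp_all add: load_def algebra_simps)

lemma vfield3_le_load:
  assumes "0 < a" "a < 1/2" "0 < x" "0 < y" "0 < z"
  shows "\<bar>vfield3 a x y z\<bar> \<le> 3 * load x y z * x"
proof -
  define q where "q = x\<^sup>2 + y\<^sup>2 + z\<^sup>2"
  have sq: "2 * (x * y) \<le> x\<^sup>2 + y\<^sup>2" "2 * (x * z) \<le> x\<^sup>2 + z\<^sup>2" "2 * (y * z) \<le> y\<^sup>2 + z\<^sup>2"
    using sum_squares_bound[of x y] sum_squares_bound[of x z] sum_squares_bound[of y z] by simp_all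
  have "0 \<le> x * (y + z)" "0 \<le> y * z" "0 \<le> x\<^sup>2" "0 \<le> y\<^sup>2" "0 \<le> z\<^sup>2" using assms by simp_all
  moreover have "x * (y + z) \<le> q" "2 * (y * z) \<le> q"
    using sq zero_le_power2[of x] zero_le_power2[of y] zero_le_power2[of z]
    unfolding q_def distrib_left by linarith+
  moreover have "\<bar>2 * a * (2 * x\<^sup>2 - y\<^sup>2 - z\<^sup>2)\<bar> \<le> 2 * q"
  proof -
    have "\<bar>2 * a\<bar> * \<bar>2 * x\<^sup>2 - y\<^sup>2 - z\<^sup>2\<bar> \<le> 1 * (2 * q)"
      using assms unfolding q_def by (intro mult_mono) (auto simp: abs_le_iff)
    then show ?thesis by (simp add: abs_mult)
  qed
  ultimately have "\<bar>x * (y + z) - 2 * a * (2 * x\<^sup>2 - y\<^sup>2 - z\<^sup>2) - 2 * (y * z)\<bar> \<le> 3 * q"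
    by linarith
  then have "\<bar>x * (y + z) - 2 * a * (2 * x\<^sup>2 - y\<^sup>2 - z\<^sup>2) - 2 * (y * z)\<bar> / (y * z) \<le> 3 * q / (y * z)"
    using assms by (intro divide_right_mono) auto
  moreover have "vfield3 a x y z = (x * (y + z) - 2 * a * (2 * x\<^sup>2 - y\<^sup>2 - z\<^sup>2) - 2 * (y * z)) / (y * z)"
    using assms by (simp add: vfield3_def field_simps power2_eq_square)
  moreover have "3 * load x y z * x = 3 * q / (y * z)"
    using assms by (simp add: load_def q_def)
  ultimately show ?thesis using assms by (simp add: abs_divide)
qed

text \<open>A bounded functional growing at least as fast as \<open>load\<close> controls the logarithms of the
  coordinates, so the trajectory stays in a box, hence is global, and the functional is
  unbounded after all.\<close>

lemma no_bounded_functional: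
  assumes tr: "trajectory a T x" and a: "0 < a" "a < 1/2" and ijk: "{i, j, k} = UNIV" and c: "0 < c"
    and w: "\<And>t. t \<in> time_interval T \<Longrightarrow> (w has_real_derivative w' t) (at t within time_interval T)"
    and w': "\<And>t. t \<in> time_interval T \<Longrightarrow> c * load (x t $ i) (x t $ j) (x t $ k) \<le> w' t"
    and M: "\<And>t. t \<in> time_interval T \<Longrightarrow> w t \<le> M"
  shows False
proof -
  define L where "L t = load (x t $ i) (x t $ j) (x t $ k)" for t
  have sol: "solution a T x" and T: "0 < T" using tr by (auto simp: trajectory_def)
  have pos: "0 < x t $ l" if "t \<in> time_interval T" for t l
    using sol that by (auto simp: solution_def phase_def)
  have sub: "{0..t} \<subseteq> time_interval T" if "t \<in> time_interval T" for t
    using time_interval_closed_subset[OF that order_refl] .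
  have zero: "0 \<in> time_interval T" using T by (simp add: time_interval_def zero_ereal_def[symmetric])
  have L0: "0 \<le> L t" if "t \<in> time_interval T" for t
    using pos[OF that] unfolding L_def load_def
    by (intro divide_nonneg_nonneg mult_nonneg_nonneg add_nonneg_nonneg) (auto intro: less_imp_le)
  have ijk': "{j, i, k} = UNIV" "{k, i, j} = UNIV" using ijk by auto
  \<comment> \<open>A bound for how far the logarithm of any coordinate can move while
    \<open>w\<close> rises from \<open>w 0\<close> to at most \<open>M\<close>.\<close>
  define R where "R = 3 / c * (M - w 0)"
  have R: "0 \<le> R" using M[OF zero] c by (simp add: R_def)
  have component: "x 0 $ l * exp (- R) \<le> x t $ l \<and> x t $ l \<le> x 0 $ l * exp R"
    if t: "t \<in> time_interval T" and l: "{l, m, n} = UNIV"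
      and Ll: "\<And>t. L t = load (x t $ l) (x t $ m) (x t $ n)" for t l m n
  proof -
    define g where "g t = vfield3 a (x t $ l) (x t $ m) (x t $ n) / x t $ l" for t
    have g: "\<bar>g s\<bar> \<le> 3 / c * w' s" if s: "s \<in> time_interval T" for s
    proof -
      have "\<bar>g s\<bar> \<le> 3 * L s"
        using vfield3_le_load[OF a pos[OF s, of l] pos[OF s, of m] pos[OF s, of n]] pos[OF s, of l]
        by (simp add: g_def Ll abs_divide divide_simps)
      also have "\<dots> \<le> 3 / c * w' s" using w'[OF s] c by (simp add: L_def field_simps)
      finally show ?thesis .
    qed
    have ln: "((\<lambda>s. ln (x s $ l)) has_real_derivative g s) (at s within {0..t})" if "s \<in> {0..t}" for s
    proof -
      have s: "s \<in> time_interval T" using that sub[OF t] by blast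
      show ?thesis unfolding g_def
        using DERIV_chain2[OF DERIV_ln_divide[OF pos[OF s, of l]]
          DERIV_subset[OF component_derivative[OF sol s l] sub[OF t]]] by simp
    qed
    have wt: "(w has_real_derivative w' s) (at s within {0..t})" if "s \<in> {0..t}" for s
      using that sub[OF t] by (blast intro: DERIV_subset w)
    have t0: "0 \<le> t" using t by (simp add: time_interval_def)
    \<comment> \<open>Both \<open>3 / c * w + ln\<close> and \<open>3 / c * w - ln\<close> are
      nondecreasing, since \<open>3 / c * w'\<close> dominates the absolute value of
      \<open>g\<close>.\<close>
    have 1: "3 / c * w 0 + ln (x 0 $ l) \<le> 3 / c * w t + ln (x t $ l)"
    proof (rule has_real_derivative_within_mono[OF t0])
      show "((\<lambda>t. 3 / c * w t + ln (x t $ l)) has_real_derivative 3 / c * w' s + g s) (at s within {0..t})"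
        if "s \<in> {0..t}" for s by (intro DERIV_add DERIV_cmult wt ln that)
      show "0 \<le> 3 / c * w' s + g s" if "s \<in> {0..t}" for s using g[of s] that sub[OF t] by force
    qed
    have 2: "3 / c * w 0 - ln (x 0 $ l) \<le> 3 / c * w t - ln (x t $ l)"
    proof (rule has_real_derivative_within_mono[OF t0])
      show "((\<lambda>t. 3 / c * w t - ln (x t $ l)) has_real_derivative 3 / c * w' s - g s) (at s within {0..t})"
        if "s \<in> {0..t}" for s by (intro DERIV_diff DERIV_cmult wt ln that)
      show "0 \<le> 3 / c * w' s - g s" if "s \<in> {0..t}" for s using g[of s] that sub[OF t] by force
    qed
    have "3 / c * w t \<le> 3 / c * M" using M[OF t] c by (simp add: divide_right_mono)
    then have "ln (x 0 $ l) - R \<le> ln (x t $ l)" "ln (x t $ l) \<le> ln (x 0 $ l) + R"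
      using 1 2 unfolding R_def right_diff_distrib by linarith+
    then have "exp (ln (x 0 $ l) - R) \<le> exp (ln (x t $ l))" "exp (ln (x t $ l)) \<le> exp (ln (x 0 $ l) + R)"
      by simp_all
    then show ?thesis using pos[OF t, of l] pos[OF zero, of l]
      by (simp add: exp_diff exp_add exp_minus divide_inverse)
  qed
  have bounds: "\<forall>l. x 0 $ l * exp (- R) \<le> x t $ l \<and> x t $ l \<le> x 0 $ l * exp R"
    if "t \<in> time_interval T" for t
    unfolding all_index3[OF ijk, of "\<lambda>l. x 0 $ l * exp (- R) \<le> x t $ l \<and> x t $ l \<le> x 0 $ l * exp R"]
    using component[OF that ijk L_def] component[OF that ijk'(1)] component[OF that ijk'(2)]
      load_commute unfolding L_def by blast
  define m where "m = (MIN l. x 0 $ l * exp (- R))"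
  define N where "N = (MAX l. x 0 $ l * exp R)"
  have m: "0 < m" using pos[OF zero] by (simp add: m_def)
  have box: "m \<le> x t $ l \<and> x t $ l \<le> N" if "t \<in> time_interval T" for t l
  proof -
    have "m \<le> x 0 $ l * exp (- R)" "x 0 $ l * exp R \<le> N" by (simp_all add: m_def N_def)
    then show ?thesis using bounds[OF that] by (meson order_trans)
  qed
  have "T = \<infinity>" using trajectory_in_box_global[OF tr m box] .
  then have J: "t \<in> time_interval T" if "0 \<le> t" for t using that by (simp add: time_interval_def)
  \<comment> \<open>A lower bound for \<open>c * load\<close> on the box with sides from
    \<open>m\<close> to \<open>N\<close>, hence for the growth rate of \<open>w\<close>.\<close>
  define d where "d = c * (m\<^sup>2 / (N * N * N))"
  have mN: "m \<le> N" using box[OF zero] order_trans by blast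
  have d: "0 < d" using m mN c by (simp add: d_def)
  have "d \<le> w' t" if "t \<in> time_interval T" for t
  proof -
    have p: "0 < x t $ l" "m \<le> x t $ l" "x t $ l \<le> N" for l using pos[OF that] box[OF that] by auto
    have "m\<^sup>2 \<le> (x t $ i)\<^sup>2" using m p by (intro power_mono) auto
    then have "m\<^sup>2 \<le> (x t $ i)\<^sup>2 + (x t $ j)\<^sup>2 + (x t $ k)\<^sup>2"
      using zero_le_power2[of "x t $ j"] zero_le_power2[of "x t $ k"] by linarith
    moreover have "x t $ i * x t $ j * x t $ k \<le> N * N * N"
      using p(1)[of i] p(1)[of j] p(1)[of k] p(3)[of i] p(3)[of j] p(3)[of k] m mN
      by (intro mult_mono) simp_all
    moreover have "0 < x t $ i * x t $ j * x t $ k" using p(1) by (intro mult_pos_pos)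
    ultimately have "m\<^sup>2 / (N * N * N) \<le> L t"
      unfolding L_def load_def by (intro frac_le) simp_all
    then have "d \<le> c * L t" unfolding d_def using c by (intro mult_left_mono) auto
    then show ?thesis using w'[OF that] by (simp add: L_def)
  qed
  note d_le = this
  \<comment> \<open>By this time \<open>w\<close> has grown by at least \<open>M - w 0 + 1\<close>
    and exceeds its bound.\<close>
  define t where "t = (M - w 0 + 1) / d"
  have t: "0 \<le> t" using M[OF zero] d by (simp add: t_def)
  have "w 0 - d * 0 \<le> w t - d * t"
  proof (rule has_real_derivative_within_mono[OF t])
    show "((\<lambda>t. w t - d * t) has_real_derivative w' s - d) (at s within {0..t})" if "s \<in> {0..t}" for s
      using DERIV_subset[OF w[OF J] sub[OF J[OF t]], of s] that
      by (auto intro!: derivative_eq_intros)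
    show "0 \<le> w' s - d" if "s \<in> {0..t}" for s using d_le[OF J] that by simp
  qed
  moreover have "d * t = M - w 0 + 1" using d by (simp add: t_def)
  ultimately show False using M[OF J[OF t]] by simp
qed

lemma continuous_on_rates:
  fixes f g h :: "real \<Rightarrow> real"
  assumes "continuous_on A f" "continuous_on A g" "continuous_on A h"
    and "\<And>r. r \<in> A \<Longrightarrow> f r * g r * h r \<noteq> 0"
  shows "continuous_on A (\<lambda>r. diff_rate a (f r) (g r) (h r))"
    and "(\<And>r. r \<in> A \<Longrightarrow> f r - (sqrt (f r - g r) - sqrt (f r - h r))\<^sup>2 \<noteq> 0) \<Longrightarrow>
      continuous_on A (\<lambda>r. gam3_rate a (f r) (g r) (h r))"
  unfolding diff_rate_def gam3_rate_def by (intro continuous_intros ballI assms; assumption)+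

lemma DERIV_gam3:
  assumes "(f has_real_derivative p) (at t within A)" "(g has_real_derivative q) (at t within A)"
    "(h has_real_derivative r) (at t within A)"
  shows "((\<lambda>t. gam3 (f t) (g t) (h t)) has_real_derivative
    2 * (g t - h t) * (q - r) + 2 * p * (g t + h t) + 2 * f t * (q + r) - 6 * f t * p) (at t within A)"
proof -
  have "((\<lambda>t. (g t - h t) * (g t - h t) + 2 * f t * (g t + h t) - 3 * (f t * f t)) has_real_derivative
      (q - r) * (g t - h t) + (q - r) * (g t - h t) + ((2 * p) * (g t + h t) + (q + r) * (2 * f t))
      - 3 * (p * f t + p * f t)) (at t within A)"
    by (intro DERIV_diff DERIV_add DERIV_mult DERIV_cmult assms)
  then show ?thesis unfolding gam3_def power2_eq_square
    by (rule DERIV_cong) (simp add: algebra_simps)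
qed

text \<open>The ordering is required at time 0 only. As it persists, by \<open>order\<close>, the
  indices are chosen once for the whole trajectory.\<close>

locale sorted_trajectory =
  fixes a :: real and T :: ereal and x :: "real \<Rightarrow> real ^ 3" and i j k :: 3
  assumes a: "0 < a" "a < 1/2" and tr: "trajectory a T x" and ijk: "{i, j, k} = UNIV"
    and sorted: "x 0 $ k \<le> x 0 $ j" "x 0 $ j \<le> x 0 $ i"
begin

abbreviation "J \<equiv> time_interval T"
abbreviation "X t \<equiv> x t $ i"
abbreviation "Y t \<equiv> x t $ j"
abbreviation "Z t \<equiv> x t $ k"
abbreviation "\<gamma> t \<equiv> gam3 (X t) (Y t) (Z t)"
abbreviation "\<Psi> t \<equiv> Psi a (X t) (Y t) (Z t)"

lemma sol: "solution a T x" and zero: "0 \<in> J"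
  using tr by (auto simp: trajectory_def time_interval_def zero_ereal_def[symmetric])

lemma in_phase: "t \<in> J \<Longrightarrow> x t \<in> phase"
  using sol by (auto simp: solution_def)

lemma pos: "t \<in> J \<Longrightarrow> 0 < x t $ l"
  using in_phase by (auto simp: phase_def)

lemma sub: "t \<in> J \<Longrightarrow> 0 \<le> s \<Longrightarrow> {s..t} \<subseteq> J"
  by (rule time_interval_closed_subset)

lemma perms: "{i, k, j} = UNIV" "{j, i, k} = UNIV" "{j, k, i} = UNIV" "{k, i, j} = UNIV"
  "{k, j, i} = UNIV"
  using ijk by auto

lemma component_continuous: "A \<subseteq> J \<Longrightarrow> continuous_on A (\<lambda>t. x t $ l)"
  using continuous_on_subset[OF solution_continuous_on[OF sol]] by (intro continuous_intros)

lemma deriv: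
  assumes "t \<in> J" "{l, m, n} = UNIV"
  shows "((\<lambda>t. x t $ l) has_real_derivative vfield3 a (x t $ l) (x t $ m) (x t $ n)) (at t within J)"
  using component_derivative[OF sol assms] .

lemma diff_deriv:
  assumes "t \<in> J" "{l, m, n} = UNIV"
  shows "((\<lambda>t. x t $ l - x t $ m) has_real_derivative
    diff_rate a (x t $ l) (x t $ m) (x t $ n) * (x t $ l - x t $ m)) (at t within J)"
proof -
  have "{m, l, n} = UNIV" using assms(2) by auto
  from DERIV_diff[OF deriv[OF assms] deriv[OF assms(1) this]] show ?thesis
    using vfield3_diff[of "x t $ l" "x t $ m" "x t $ n" a] pos[OF assms(1)] by (simp add: less_imp_neq[symmetric])
qed

lemma diff_factor:
  assumes "t \<in> J" "{l, m, n} = UNIV"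
  shows "\<exists>c>0. x t $ l - x t $ m = c * (x 0 $ l - x 0 $ m)"
proof (cases "t = 0")
  case True
  then show ?thesis by (intro exI[of _ 1]) simp
next
  case False
  then have t: "0 < t" using assms(1) by (simp add: time_interval_def)
  note sb = sub[OF assms(1) order_refl]
  define h where "h r = diff_rate a (x r $ l) (x r $ m) (x r $ n)" for r
  define y where "y r = x r $ l - x r $ m" for r
  have "\<exists>c>0. \<exists>e>0. \<exists>r\<in>{0<..<t}. y t = c * y 0 + e * 0"
  proof (rule linear_ode_comparison[where y = y and h = h and F = "\<lambda>_. 0", OF t])
    show "continuous_on {0..t} h"
      unfolding h_def
    proof (intro continuous_on_rates(1) component_continuous sb)
      show "x r $ l * x r $ m * x r $ n \<noteq> 0" if "r \<in> {0..t}" for r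
        using pos[OF subsetD[OF sb that], of l] pos[OF subsetD[OF sb that], of m]
          pos[OF subsetD[OF sb that], of n] by simp
    qed
    show "(y has_real_derivative h r * y r + 0) (at r within {0..t})"
      if "r \<in> {0..t}" for r
      using DERIV_subset[OF diff_deriv[OF subsetD[OF sb that] assms(2)] sb]
      unfolding y_def h_def add_0_right .
  qed
  then show ?thesis unfolding y_def by auto
qed

lemma order:
  assumes "t \<in> J"
  shows "Z t \<le> Y t" "Y t \<le> X t" "Y t < X t \<longleftrightarrow> Y 0 < X 0" "Z t < Y t \<longleftrightarrow> Z 0 < Y 0" "Z t < X t \<longleftrightarrow> Z 0 < X 0"
proof -
  have sign: "(x t $ m < x t $ l \<longleftrightarrow> x 0 $ m < x 0 $ l) \<and> (x t $ m \<le> x t $ l \<longleftrightarrow> x 0 $ m \<le> x 0 $ l)"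
    if lmn: "{l, m, n} = UNIV" for l m n
  proof -
    obtain c where c: "c > 0" "x t $ l - x t $ m = c * (x 0 $ l - x 0 $ m)"
      using diff_factor[OF assms lmn] by blast
    have "0 < x t $ l - x t $ m \<longleftrightarrow> 0 < x 0 $ l - x 0 $ m"
      "0 \<le> x t $ l - x t $ m \<longleftrightarrow> 0 \<le> x 0 $ l - x 0 $ m"
      unfolding c(2) using c(1) by (simp_all add: zero_less_mult_iff zero_le_mult_iff)
    then show ?thesis by simp
  qed
  show "Z t \<le> Y t" "Y t \<le> X t" "Y t < X t \<longleftrightarrow> Y 0 < X 0" "Z t < Y t \<longleftrightarrow> Z 0 < Y 0"
    "Z t < X t \<longleftrightarrow> Z 0 < X 0"
    using sign[OF ijk] sign[OF perms(3)] sign[OF perms(1)] sorted by simp_all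
qed

lemma gam3_deriv:
  assumes "t \<in> J"
  shows "(\<gamma> has_real_derivative gam3_rate a (X t) (Y t) (Z t) * \<gamma> t
    + 6 * X t / (X t * Y t * Z t) * ((X t - Y t) * (X t - Z t) * \<Psi> t)) (at t within J)"
  by (rule DERIV_cong[OF DERIV_gam3[OF deriv[OF assms ijk] deriv[OF assms perms(2)]
    deriv[OF assms perms(4)]] gam3_derivative[OF pos[OF assms] order(1,2)[OF assms]]])

lemma gam3_step:
  assumes "t \<in> J" "0 \<le> s" "s < t"
  shows "\<exists>m>0. \<exists>e>0. \<exists>r\<in>{s<..<t}. \<gamma> t = m * \<gamma> s + e * ((X r - Y r) * (X r - Z r) * \<Psi> r)"
proof -
  define F where "F r = 6 * X r / (X r * Y r * Z r) * ((X r - Y r) * (X r - Z r) * \<Psi> r)" for r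
  note sb = sub[OF assms(1,2)]
  have "\<exists>m>0. \<exists>e>0. \<exists>r\<in>{s<..<t}. \<gamma> t = m * \<gamma> s + e * F r"
  proof (rule linear_ode_comparison[where y = \<gamma> and F = F
        and h = "\<lambda>r. gam3_rate a (X r) (Y r) (Z r)", OF assms(3)])
    have W: "X r - (sqrt (X r - Y r) - sqrt (X r - Z r))\<^sup>2 \<noteq> 0" if "r \<in> {s..t}" for r
    proof -
      have r: "r \<in> J" using sb that by blast
      from sqrt_diff_bound[OF pos[OF r] order(1)[OF r] order(2)[OF r]] show ?thesis
        by (rule less_imp_neq[THEN not_sym])
    qed
    have V: "X r * Y r * Z r \<noteq> 0" if "r \<in> {s..t}" for r
      using pos[OF subsetD[OF sb that], of i] pos[OF subsetD[OF sb that], of j]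
        pos[OF subsetD[OF sb that], of k] by simp
    show "continuous_on {s..t} (\<lambda>r. gam3_rate a (X r) (Y r) (Z r))"
      by (intro continuous_on_rates(2) component_continuous sb W V)
    show "(\<gamma> has_real_derivative gam3_rate a (X r) (Y r) (Z r) * \<gamma> r + F r) (at r within {s..t})"
      if "r \<in> {s..t}" for r
      using DERIV_subset[OF gam3_deriv[OF subsetD[OF sb that]] sb] unfolding F_def .
  qed
  then obtain m e r where *: "0 < m" "0 < e" "r \<in> {s<..<t}" "\<gamma> t = m * \<gamma> s + e * F r" by blast
  have r: "r \<in> J" using *(3) sb by auto
  have "0 < e * (6 * X r / (X r * Y r * Z r))"
    using *(2) pos[OF r, of i] pos[OF r, of j] pos[OF r, of k] by simp
  moreover have "\<gamma> t = m * \<gamma> s + e * (6 * X r / (X r * Y r * Z r)) * ((X r - Y r) * (X r - Z r) * \<Psi> r)"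
    unfolding *(4) F_def by (simp only: mult.assoc)
  ultimately show ?thesis using *(1,3) by blast
qed

text \<open>The logarithmic derivative of a quotient of two solutions of linear equations is the
  difference of their rates. This difference factors and has a fixed sign; it vanishes only for Y =
  Z.\<close>

lemma ratio_deriv:
  assumes r: "r \<in> J" and "Y 0 < X 0"
  shows "((\<lambda>t. (X t - Y t) / (X t - Z t)) has_real_derivative
    - ((X r - Y r) / (X r - Z r) * (6 * a * ((Y r - Z r) * (X r + Y r + Z r)) / (X r * Y r * Z r))))
    (at r within J)"
proof -
  have nz: "X r - Z r \<noteq> 0" "x r $ l \<noteq> 0" for l using order[OF r] assms(2) pos[OF r, of l] by auto
  have rates: "diff_rate a (X r) (Z r) (Y r) - diff_rate a (X r) (Y r) (Z r)
      = 6 * a * ((Y r - Z r) * (X r + Y r + Z r)) / (X r * Y r * Z r)"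
    using nz(2) unfolding diff_rate_def
    by (simp add: divide_simps) (simp add: algebra_simps power2_eq_square)
  have "((\<lambda>t. (X t - Y t) / (X t - Z t)) has_real_derivative
      (diff_rate a (X r) (Y r) (Z r) * (X r - Y r) * (X r - Z r)
        - (X r - Y r) * (diff_rate a (X r) (Z r) (Y r) * (X r - Z r))) / ((X r - Z r) * (X r - Z r)))
      (at r within J)"
    by (intro DERIV_divide diff_deriv[OF r ijk] diff_deriv[OF r perms(1)] nz)
  moreover have "(diff_rate a (X r) (Y r) (Z r) * (X r - Y r) * (X r - Z r)
        - (X r - Y r) * (diff_rate a (X r) (Z r) (Y r) * (X r - Z r))) / ((X r - Z r) * (X r - Z r))
      = - ((X r - Y r) / (X r - Z r) * (diff_rate a (X r) (Z r) (Y r) - diff_rate a (X r) (Y r) (Z r)))"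
    using nz(1) by (simp add: divide_simps) (simp add: algebra_simps)
  ultimately show ?thesis unfolding rates by (rule DERIV_cong)
qed

lemma ratio_antimono:
  assumes "t \<in> J" "0 \<le> s" "s \<le> t" "Y 0 < X 0"
  shows "(X t - Y t) / (X t - Z t) \<le> (X s - Y s) / (X s - Z s)"
proof -
  have "- ((X s - Y s) / (X s - Z s)) \<le> - ((X t - Y t) / (X t - Z t))"
  proof (rule has_real_derivative_within_mono[OF assms(3)])
    fix r assume "r \<in> {s..t}"
    then have r: "r \<in> J" using sub[OF assms(1,2)] by blast
    define D where "D = (X r - Y r) / (X r - Z r)
      * (6 * a * ((Y r - Z r) * (X r + Y r + Z r)) / (X r * Y r * Z r))"
    from DERIV_subset[OF DERIV_minus[OF ratio_deriv[OF r assms(4)]] sub[OF assms(1,2)]]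
    show "((\<lambda>t. - ((X t - Y t) / (X t - Z t))) has_real_derivative D) (at r within {s..t})"
      unfolding D_def minus_minus .
    show "0 \<le> D"
      unfolding D_def using a pos[OF r, of i] pos[OF r, of j] pos[OF r, of k] order(1,2)[OF r]
      by (intro mult_nonneg_nonneg divide_nonneg_nonneg) auto
  qed
  then show ?thesis by simp
qed

end

section \<open>Crossing the boundary\<close>

text \<open>Completing the square moves the threshold 3/14 into the first coefficient and leaves 1/4
  in the second; for \<open>a \<le> 3/14\<close> both terms are nonpositive.\<close>

lemma Psi_eq:
  assumes "z \<le> y" "y \<le> x"
  shows "Psi a x y z = 2 * (42 * a - 9) * (sqrt (x - y) * sqrt (x - z))
    - (4 - 16 * a) * (sqrt (x - y) - sqrt (x - z))\<^sup>2"
proof -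
  define \<alpha> \<beta> where "\<alpha> = sqrt (x - y)" and "\<beta> = sqrt (x - z)"
  have sq: "x - y = \<alpha>\<^sup>2" "x - z = \<beta>\<^sup>2" using assms by (simp_all add: \<alpha>_def \<beta>_def)
  have "2 * (26 * a - 5) * \<alpha> * \<beta> - (4 - 16 * a) * (\<alpha>\<^sup>2 + \<beta>\<^sup>2)
      = 2 * (42 * a - 9) * (\<alpha> * \<beta>) - (4 - 16 * a) * (\<alpha> - \<beta>)\<^sup>2"
    by algebra
  then show ?thesis unfolding Psi_def \<alpha>_def[symmetric] \<beta>_def[symmetric] unfolding sq .
qed

lemma Psi_nonneg:
  assumes "1/4 \<le> a" "z \<le> y" "y \<le> x"
  shows "0 \<le> Psi a x y z" "y < x \<Longrightarrow> 0 < Psi a x y z"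
proof -
  have "0 \<le> (16 * a - 4) * ((x - y) + (x - z))" using assms by (intro mult_nonneg_nonneg) auto
  moreover have "0 \<le> 2 * (26 * a - 5) * sqrt (x - y) * sqrt (x - z)" using assms by simp
  ultimately show "0 \<le> Psi a x y z" unfolding Psi_def by (simp add: algebra_simps)
  assume "y < x"
  then have "0 < 2 * (26 * a - 5) * sqrt (x - y) * sqrt (x - z)" using assms by simp
  with \<open>0 \<le> (16 * a - 4) * ((x - y) + (x - z))\<close> show "0 < Psi a x y z"
    unfolding Psi_def by (simp add: algebra_simps)
qed

text \<open>Strictness has two sources: below 3/14 the product of the roots has a negative
  coefficient; at 3/14 that term vanishes and only the square is left, which is nonzero when
  \<open>z < y\<close>.\<close>

lemma Psi_nonpos:
  assumes "a \<le> 3/14" "z \<le> y" "y \<le> x"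
  shows "Psi a x y z \<le> 0" "y < x \<Longrightarrow> z < y \<or> a < 3/14 \<Longrightarrow> Psi a x y z < 0"
proof -
  let ?p = "2 * (9 - 42 * a) * (sqrt (x - y) * sqrt (x - z))"
  let ?q = "(4 - 16 * a) * (sqrt (x - y) - sqrt (x - z))\<^sup>2"
  have eq: "Psi a x y z = - ?p - ?q" unfolding Psi_eq[OF assms(2,3)] by (simp add: algebra_simps)
  have p: "0 \<le> ?p" using assms by (intro mult_nonneg_nonneg) auto
  have q: "0 \<le> ?q" using assms by (intro mult_nonneg_nonneg) auto
  show "Psi a x y z \<le> 0" using p q eq by linarith
  assume xy: "y < x" and or: "z < y \<or> a < 3/14"
  have "0 < ?p \<or> 0 < ?q"
  proof (cases "a < 3/14")
    case True
    then have "0 < ?p" using xy assms by (intro mult_pos_pos) auto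
    then show ?thesis by blast
  next
    case False
    then have "sqrt (x - y) \<noteq> sqrt (x - z)" using or by simp
    then have "0 < ?q" using assms by (intro mult_pos_pos) auto
    then show ?thesis by blast
  qed
  then show "Psi a x y z < 0" using p q eq by linarith
qed

lemma Psi_ratio:
  assumes "z \<le> y" "y < x"
  shows "Psi a x y z = (x - z) * (2 * (26 * a - 5) * sqrt ((x - y) / (x - z))
    - (4 - 16 * a) * (1 + (x - y) / (x - z)))"
proof -
  have "sqrt (x - y) * sqrt (x - z) = (x - z) * sqrt ((x - y) / (x - z))"
    using assms real_sqrt_mult_self[of "x - z"] by (simp add: real_sqrt_divide divide_simps)
  moreover have "(x - z) * (1 + (x - y) / (x - z)) = (x - y) + (x - z)" using assms by (simp add: field_simps)
  moreover have "(x - z) * (2 * (26 * a - 5) * s - (4 - 16 * a) * u)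
      = 2 * (26 * a - 5) * ((x - z) * s) - (4 - 16 * a) * ((x - z) * u)" for s u
    by (simp add: algebra_simps)
  ultimately show ?thesis unfolding Psi_def mult.assoc by simp
qed

text \<open>In the variable \<open>sqrt u\<close> the bracket is quadratic, and its difference
  quotient is at least 2 (26 a - 5) - 2 (4 - 16 a) = 84 a - 18, which is nonnegative from 3/14
  on.\<close>

lemma ratio_bracket_mono:
  fixes a u v :: real
  assumes "3/14 \<le> a" "a \<le> 1/4" "0 \<le> u" "u \<le> v" "v \<le> 1"
  shows "2 * (26 * a - 5) * sqrt u - (4 - 16 * a) * (1 + u)
    \<le> 2 * (26 * a - 5) * sqrt v - (4 - 16 * a) * (1 + v)"
proof -
  define s t where "s = sqrt u" and "t = sqrt v"
  have st: "0 \<le> s" "s \<le> t" "t \<le> 1" "u = s\<^sup>2" "v = t\<^sup>2"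
    using assms by (simp_all add: s_def t_def)
  have "(4 - 16 * a) * (s + t) \<le> (4 - 16 * a) * 2" using assms st by (intro mult_left_mono) auto
  then have "0 \<le> (t - s) * (2 * (26 * a - 5) - (4 - 16 * a) * (s + t))"
    using assms st by (intro mult_nonneg_nonneg) auto
  also have "\<dots> = (2 * (26 * a - 5) * t - (4 - 16 * a) * (1 + t\<^sup>2))
      - (2 * (26 * a - 5) * s - (4 - 16 * a) * (1 + s\<^sup>2))"
    by (simp add: power2_eq_square algebra_simps)
  finally show ?thesis unfolding s_def[symmetric] t_def[symmetric] st(4,5)[symmetric] by simp
qed

text \<open>The derivative of \<open>ln (x - y) + 2 ln (x - z) - ln x - 2 ln z\<close> along the field is
  \<open>3 gain / (x y z)\<close>.\<close>

definition gain :: "real \<Rightarrow> real \<Rightarrow> real \<Rightarrow> real \<Rightarrow> real" where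
  "gain a x y z = 3 * (1 - 4 * a) * x\<^sup>2 - (1 - 4 * a) * x * (x - z) - (3 - 6 * a) * x * (x - y)
     - 2 * a * (x - y)\<^sup>2 + (x - y) * (x - z)"

lemma gain_eq:
  assumes "x \<noteq> 0" "y \<noteq> 0" "z \<noteq> 0"
  shows "diff_rate a x y z + 2 * diff_rate a x z y - vfield3 a x y z / x - 2 * (vfield3 a z x y / z)
    = 3 * gain a x y z / (x * y * z)"
  using assms unfolding diff_rate_def vfield3_def gain_def
  by (simp add: divide_simps) (simp add: algebra_simps power2_eq_square)

text \<open>What stays negative is \<open>- 3 * (x * (x - y))\<close>; in
  \<open>leaves_region\<close> the derivative of the ratio term pays for it.\<close>

lemma gain_ge_quarter:
  assumes "0 \<le> a" "a \<le> 1/4" "0 < z" "z \<le> y" "y \<le> x"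
  shows "2 * (1 - 4 * a) * x\<^sup>2 - 3 * (x * (x - y)) \<le> gain a x y z"
proof -
  have "gain a x y z = 2 * (1 - 4 * a) * x\<^sup>2 - 3 * (x * (x - y)) + (1 - 4 * a) * x * z
      + 2 * a * (x - y) * (2 * x + y) + (x - y) * (x - z)"
    by (simp add: gain_def power2_eq_square algebra_simps)
  moreover have "0 \<le> (1 - 4 * a) * x * z" "0 \<le> 2 * a * (x - y) * (2 * x + y)" "0 \<le> (x - y) * (x - z)"
    using assms by (auto intro!: mult_nonneg_nonneg)
  ultimately show ?thesis by linarith
qed

lemma gain_le:
  assumes "1/4 < a" "a < 1/2" "0 < z" "z \<le> y" "y \<le> x"
  shows "gain a x y z \<le> - ((4 * a - 1) / 2) * x\<^sup>2"
proof -
  have "(4 * a - 1) * x * (x - z) \<le> (4 * a - 1) * x * x" "(x - y) * (x - z) \<le> (x - y) * x"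
    using assms by (auto intro!: mult_left_mono)
  moreover have "0 \<le> 2 * a * (x - y)\<^sup>2" using assms by simp
  \<comment> \<open>The factor on the right is 6 a - 3/2, which exceeds 6 a - 2; the half of
    \<open>4 * a - 1\<close> held back becomes the final bound. The cases arise because 6 a - 2 may
    have either sign.\<close>
  moreover have "(6 * a - 2) * (x - y) * x \<le> (2 * (4 * a - 1) - (4 * a - 1) / 2) * x * x"
  proof (rule mult_right_mono)
    show "(6 * a - 2) * (x - y) \<le> (2 * (4 * a - 1) - (4 * a - 1) / 2) * x"
    proof (cases "6 * a \<le> 2")
      case True
      then have "(6 * a - 2) * (x - y) \<le> 0" using assms by (intro mult_nonpos_nonneg) auto
      moreover have "0 \<le> (2 * (4 * a - 1) - (4 * a - 1) / 2) * x"
        using assms by (intro mult_nonneg_nonneg) auto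
      ultimately show ?thesis by linarith
    next
      case False
      then have "(6 * a - 2) * (x - y) \<le> (6 * a - 2) * x" using assms by (intro mult_left_mono) auto
      also have "\<dots> \<le> (2 * (4 * a - 1) - (4 * a - 1) / 2) * x"
        using assms False by (intro mult_right_mono) auto
      finally show ?thesis .
    qed
  qed (use assms in simp)
  ultimately show ?thesis by (simp add: gain_def power2_eq_square algebra_simps)
qed

text \<open>This is 7 \<open>gain\<close> at a = 3/14, in units with x = 1 and with \<alpha>^2 = x -
  y, \<beta>^2 = x - z. It vanishes at \<alpha> = \<beta> = 1/2, the point of the surface with y =
  z, so the estimate is sharp.\<close>

lemma gain_critical_poly:
  fixes \<alpha> \<beta> :: real
  assumes "0 \<le> \<alpha>" "\<alpha> \<le> \<beta>" "\<alpha> + \<beta> \<le> 1"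
  shows "0 \<le> 3 - \<beta>\<^sup>2 - 12 * \<alpha>\<^sup>2 - 3 * (\<alpha>\<^sup>2)\<^sup>2 + 7 * \<alpha>\<^sup>2 * \<beta>\<^sup>2"
proof (cases "7 * \<alpha>\<^sup>2 \<le> 1")
  case True
  \<comment> \<open>The polynomial is affine in \<beta>^2. Here the slope is nonpositive, so the
    worst case is the largest value, \<beta> = 1 - \<alpha>.\<close>
  have "\<beta>\<^sup>2 \<le> (1 - \<alpha>)\<^sup>2" using assms by (intro power_mono) auto
  then have "(1 - 7 * \<alpha>\<^sup>2) * \<beta>\<^sup>2 \<le> (1 - 7 * \<alpha>\<^sup>2) * (1 - \<alpha>)\<^sup>2" using True by (intro mult_left_mono) auto
  moreover have "3 - 12 * \<alpha>\<^sup>2 - 3 * (\<alpha>\<^sup>2)\<^sup>2 - (1 - 7 * \<alpha>\<^sup>2) * (1 - \<alpha>)\<^sup>2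
      = (1 - 2 * \<alpha>) * (2 + 6 * \<alpha> + 4 * \<alpha>\<^sup>2 + 2 * \<alpha>\<^sup>2 * (1 - \<alpha>))"
    by (simp add: power2_eq_square algebra_simps)
  moreover have "0 \<le> (1 - 2 * \<alpha>) * (2 + 6 * \<alpha> + 4 * \<alpha>\<^sup>2 + 2 * \<alpha>\<^sup>2 * (1 - \<alpha>))"
    using assms by (intro mult_nonneg_nonneg add_nonneg_nonneg) auto
  ultimately show ?thesis by (simp add: algebra_simps)
next
  case False
  \<comment> \<open>Now the slope is positive and the worst case is the smallest value, \<beta> =
    \<alpha>.\<close>
  have "\<alpha>\<^sup>2 \<le> \<beta>\<^sup>2" "\<alpha>\<^sup>2 \<le> (1/2)\<^sup>2" using assms by (auto intro!: power_mono)
  then have "(7 * \<alpha>\<^sup>2 - 1) * \<alpha>\<^sup>2 \<le> (7 * \<alpha>\<^sup>2 - 1) * \<beta>\<^sup>2" using False by (intro mult_left_mono) auto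
  moreover have "3 - 12 * \<alpha>\<^sup>2 - 3 * (\<alpha>\<^sup>2)\<^sup>2 + (7 * \<alpha>\<^sup>2 - 1) * \<alpha>\<^sup>2 = (1 - 4 * \<alpha>\<^sup>2) * (3 - \<alpha>\<^sup>2)"
    by (simp add: power2_eq_square algebra_simps)
  moreover have "0 \<le> (1 - 4 * \<alpha>\<^sup>2) * (3 - \<alpha>\<^sup>2)"
    using \<open>\<alpha>\<^sup>2 \<le> (1/2)\<^sup>2\<close> by (intro mult_nonneg_nonneg) (auto simp: power2_eq_square)
  ultimately show ?thesis by (simp add: algebra_simps)
qed

text \<open>\<open>gain\<close> is affine in \<open>a\<close>: its value at 3/14 is nonnegative by
  \<open>gain_critical_poly\<close>, and \<open>3/14 - a\<close> is multiplied by at least twice the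
  square of \<open>x\<close>.\<close>

lemma gain_ge_critical:
  assumes "a \<le> 3/14" "0 < z" "z \<le> y" "y \<le> x" "0 \<le> gam3 x y z"
  shows "2 * (3/14 - a) * x\<^sup>2 \<le> gain a x y z"
proof -
  have x: "0 < x" using assms by simp
  define \<alpha> \<beta> where "\<alpha> = sqrt (x - y) / sqrt x" and "\<beta> = sqrt (x - z) / sqrt x"
  have sq: "x - y = x * \<alpha>\<^sup>2" "x - z = x * \<beta>\<^sup>2"
    using assms x by (simp_all add: \<alpha>_def \<beta>_def power_divide)
  have "sqrt (x - y) + sqrt (x - z) \<le> sqrt x"
    by (rule real_le_rsqrt[OF gam3_nonneg_sqrt[OF assms(2-5)]])
  then have ab: "0 \<le> \<alpha>" "\<alpha> \<le> \<beta>" "\<alpha> + \<beta> \<le> 1"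
    using assms x by (simp_all add: \<alpha>_def \<beta>_def divide_right_mono add_divide_distrib[symmetric])
  have le1: "\<alpha>\<^sup>2 \<le> 1" "\<beta>\<^sup>2 \<le> 1" using ab by (simp_all add: power_le_one)
  define P where "P = 3 - \<beta>\<^sup>2 - 12 * \<alpha>\<^sup>2 - 3 * (\<alpha>\<^sup>2)\<^sup>2 + 7 * \<alpha>\<^sup>2 * \<beta>\<^sup>2"
  have P: "0 \<le> P" unfolding P_def by (rule gain_critical_poly[OF ab])
  have "gain a x y z = x\<^sup>2 * (P / 7) + (3/14 - a) * x\<^sup>2 * (12 - 4 * \<beta>\<^sup>2 - 6 * \<alpha>\<^sup>2 + 2 * (\<alpha>\<^sup>2)\<^sup>2)"
    unfolding gain_def sq P_def by (simp add: power2_eq_square field_simps)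
  moreover have "(3/14 - a) * x\<^sup>2 * 2 \<le> (3/14 - a) * x\<^sup>2 * (12 - 4 * \<beta>\<^sup>2 - 6 * \<alpha>\<^sup>2 + 2 * (\<alpha>\<^sup>2)\<^sup>2)"
  proof (rule mult_left_mono)
    show "2 \<le> 12 - 4 * \<beta>\<^sup>2 - 6 * \<alpha>\<^sup>2 + 2 * (\<alpha>\<^sup>2)\<^sup>2"
      using le1 zero_le_power2[of "\<alpha>\<^sup>2"] by linarith
  qed (use assms in simp)
  moreover have "0 \<le> x\<^sup>2 * (P / 7)" using P by simp
  ultimately show ?thesis by linarith
qed

section \<open>Direction of crossing, and arrival at the surface\<close>

context sorted_trajectory
begin

lemma gam3_le_3_14:
  assumes "a \<le> 3/14" "t \<in> J" "0 \<le> s" "s < t"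
  shows "\<exists>m>0. \<gamma> t \<le> m * \<gamma> s"
    "Y 0 < X 0 \<Longrightarrow> Z 0 < Y 0 \<or> a < 3/14 \<Longrightarrow> \<exists>m>0. \<gamma> t < m * \<gamma> s"
proof -
  obtain m e r where *: "0 < m" "0 < e" "r \<in> {s<..<t}"
    "\<gamma> t = m * \<gamma> s + e * ((X r - Y r) * (X r - Z r) * \<Psi> r)"
    using gam3_step[OF assms(2-4)] by blast
  have r: "r \<in> J" using *(3) sub[OF assms(2,3)] by auto
  have "(X r - Y r) * (X r - Z r) * \<Psi> r \<le> 0"
    using order(1,2)[OF r] Psi_nonpos(1)[OF assms(1) order(1,2)[OF r]]
    by (intro mult_nonneg_nonpos mult_nonneg_nonneg) auto
  then have "e * ((X r - Y r) * (X r - Z r) * \<Psi> r) \<le> 0"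
    using *(2) by (simp add: mult_nonneg_nonpos)
  then show "\<exists>m>0. \<gamma> t \<le> m * \<gamma> s" using * by (intro exI[of _ m]) linarith
  assume **: "Y 0 < X 0" "Z 0 < Y 0 \<or> a < 3/14"
  have "(X r - Y r) * (X r - Z r) * \<Psi> r < 0"
    using order[OF r] ** Psi_nonpos(2)[OF assms(1) order(1,2)[OF r]]
    by (intro mult_pos_neg mult_pos_pos) auto
  then have "e * ((X r - Y r) * (X r - Z r) * \<Psi> r) < 0"
    using *(2) by (simp add: mult_pos_neg)
  then show "\<exists>m>0. \<gamma> t < m * \<gamma> s" using * by (intro exI[of _ m]) linarith
qed

lemma gam3_ge_quarter:
  assumes "1/4 \<le> a" "t \<in> J" "0 \<le> s" "s < t"
  shows "\<exists>m>0. m * \<gamma> s \<le> \<gamma> t" "Y 0 < X 0 \<Longrightarrow> \<exists>m>0. m * \<gamma> s < \<gamma> t"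
proof -
  obtain m e r where *: "0 < m" "0 < e" "r \<in> {s<..<t}"
    "\<gamma> t = m * \<gamma> s + e * ((X r - Y r) * (X r - Z r) * \<Psi> r)"
    using gam3_step[OF assms(2-4)] by blast
  have r: "r \<in> J" using *(3) sub[OF assms(2,3)] by auto
  have "0 \<le> e * ((X r - Y r) * (X r - Z r) * \<Psi> r)"
    using *(2) order(1,2)[OF r] Psi_nonneg(1)[OF assms(1) order(1,2)[OF r]]
    by (intro mult_nonneg_nonneg) auto
  then show "\<exists>m>0. m * \<gamma> s \<le> \<gamma> t" using * by (intro exI[of _ m]) linarith
  assume **: "Y 0 < X 0"
  have "0 < e * ((X r - Y r) * (X r - Z r) * \<Psi> r)"
    using *(2) order[OF r] ** Psi_nonneg(2)[OF assms(1) order(1,2)[OF r]]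
    by (intro mult_pos_pos) auto
  then show "\<exists>m>0. m * \<gamma> s < \<gamma> t" using * by (intro exI[of _ m]) linarith
qed

lemma Psi_stays_negative:
  assumes "3/14 \<le> a" "a \<le> 1/4" "Y 0 < X 0" "t \<in> J" "0 \<le> s" "s \<le> t" "\<Psi> s < 0"
  shows "\<Psi> t < 0"
proof -
  have s: "s \<in> J" using sub[OF assms(4,5)] assms(6) by auto
  define \<phi> where "\<phi> u = 2 * (26 * a - 5) * sqrt u - (4 - 16 * a) * (1 + u)" for u
  define Q where "Q r = (X r - Y r) / (X r - Z r)" for r
  have gap: "0 < X r - Z r" "Y r < X r" "\<Psi> r = (X r - Z r) * \<phi> (Q r)" if "r \<in> J" for r
    using order[OF that] assms(3) Psi_ratio[of "Z r" "Y r" "X r" a] by (auto simp: \<phi>_def Q_def)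
  have "\<phi> (Q t) \<le> \<phi> (Q s)"
    unfolding \<phi>_def
  proof (rule ratio_bracket_mono[OF assms(1,2)])
    show "0 \<le> Q t" using gap[OF assms(4)] by (simp add: Q_def)
    show "Q t \<le> Q s" unfolding Q_def by (rule ratio_antimono[OF assms(4,5,6,3)])
    show "Q s \<le> 1" using gap[OF s] order(1)[OF s] by (simp add: Q_def)
  qed
  moreover have "\<phi> (Q s) < 0" using assms(7) gap[OF s] by (simp add: mult_less_0_iff)
  ultimately show ?thesis using gap[OF assms(4)] by (simp add: mult_pos_neg)
qed

lemma functional_deriv:
  assumes t: "t \<in> J" and "Y 0 < X 0"
  shows "((\<lambda>t. ln (X t - Y t) + 2 * ln (X t - Z t) - ln (X t) - 2 * ln (Z t)
      - K * ((X t - Y t) / (X t - Z t))) has_real_derivative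
    3 * gain a (X t) (Y t) (Z t) / (X t * Y t * Z t)
      + K * ((X t - Y t) / (X t - Z t) * (6 * a * ((Y t - Z t) * (X t + Y t + Z t)) / (X t * Y t * Z t))))
    (at t within J)"
proof -
  have ln: "((\<lambda>t. ln (f t)) has_real_derivative f' / f t) (at t within J)"
    if "(f has_real_derivative f') (at t within J)" "0 < f t" for f f'
    using DERIV_chain2[OF DERIV_ln_divide that(1)] that(2) by simp
  have gap: "0 < X t - Y t" "0 < X t - Z t" using order[OF t] assms(2) by auto
  have nz: "x t $ l \<noteq> 0" for l using pos[OF t, of l] by simp
  let ?D = "(X t - Y t) / (X t - Z t) * (6 * a * ((Y t - Z t) * (X t + Y t + Z t)) / (X t * Y t * Z t))"
  have "((\<lambda>t. ln (X t - Y t) + 2 * ln (X t - Z t) - ln (X t) - 2 * ln (Z t)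
      - K * ((X t - Y t) / (X t - Z t))) has_real_derivative
    diff_rate a (X t) (Y t) (Z t) * (X t - Y t) / (X t - Y t)
      + 2 * (diff_rate a (X t) (Z t) (Y t) * (X t - Z t) / (X t - Z t))
      - vfield3 a (X t) (Y t) (Z t) / X t - 2 * (vfield3 a (Z t) (X t) (Y t) / Z t) - K * - ?D)
    (at t within J)"
    by (intro DERIV_diff DERIV_add DERIV_cmult ln diff_deriv[OF t ijk] diff_deriv[OF t perms(1)]
      deriv[OF t ijk] deriv[OF t perms(4)] ratio_deriv[OF t assms(2)] gap pos[OF t])
  moreover have "diff_rate a (X t) (Y t) (Z t) * (X t - Y t) / (X t - Y t)
      + 2 * (diff_rate a (X t) (Z t) (Y t) * (X t - Z t) / (X t - Z t))
      - vfield3 a (X t) (Y t) (Z t) / X t - 2 * (vfield3 a (Z t) (X t) (Y t) / Z t) - K * - ?D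
    = 3 * gain a (X t) (Y t) (Z t) / (X t * Y t * Z t) + K * ?D"
    using gap gain_eq[OF nz nz nz, of a i j k] by simp
  ultimately show ?thesis by (rule DERIV_cong)
qed

lemma load_le:
  assumes t: "t \<in> J" and "0 \<le> c"
  shows "c * load (X t) (Y t) (Z t) \<le> 3 * (c * (X t)\<^sup>2) / (X t * Y t * Z t)"
proof -
  have V: "0 \<le> X t * Y t * Z t" using pos[OF t] by (intro mult_nonneg_nonneg) (auto intro: less_imp_le)
  have "(Y t)\<^sup>2 \<le> (X t)\<^sup>2" "(Z t)\<^sup>2 \<le> (X t)\<^sup>2"
    using order(1,2)[OF t] pos[OF t] by (auto intro!: power_mono intro: less_imp_le)
  then have "c * ((X t)\<^sup>2 + (Y t)\<^sup>2 + (Z t)\<^sup>2) \<le> c * (3 * (X t)\<^sup>2)"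
    using assms(2) by (intro mult_left_mono) auto
  from divide_right_mono[OF this V] show ?thesis by (simp add: load_def mult_ac)
qed

text \<open>Below 3/14 the logarithms grow fast enough and \<open>K\<close> is 0. From 3/14 on the
  ratio term must help, and \<open>Z 0 < Y 0\<close> keeps the ratio at most \<open>Q 0\<close>,
  which is less than 1.\<close>

lemma leaves_region:
  assumes a4: "a < 1/4" and XY: "Y 0 < X 0" and or: "Z 0 < Y 0 \<or> a < 3/14"
  shows "\<exists>t\<in>J. \<gamma> t < 0"
proof (rule ccontr)
  assume "\<not> (\<exists>t\<in>J. \<gamma> t < 0)"
  then have \<gamma>: "0 \<le> \<gamma> t" if "t \<in> J" for t using that by force
  define Q where "Q t = (X t - Y t) / (X t - Z t)" for t
  define V where "V t = X t * Y t * Z t" for t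
  have V: "0 < V t" if "t \<in> J" for t unfolding V_def using pos[OF that] by (intro mult_pos_pos)
  have gap: "0 < X t - Y t" "0 < X t - Z t" if "t \<in> J" for t using order[OF that] XY by auto
  have "\<exists>c K. 0 < c \<and> 0 \<le> K \<and> (\<forall>t\<in>J. c * (X t)\<^sup>2 \<le> gain a (X t) (Y t) (Z t)
      + K * (Q t * (2 * a * ((Y t - Z t) * (X t + Y t + Z t)))))"
  proof (cases "a < 3/14")
    case True
    have "2 * (3/14 - a) * (X t)\<^sup>2 \<le> gain a (X t) (Y t) (Z t)" if "t \<in> J" for t
      using True by (intro gain_ge_critical pos[OF that] order[OF that] \<gamma>[OF that]) simp
    then show ?thesis using True by (intro exI[of _ "2 * (3/14 - a)"] exI[of _ 0]) simp
  next
    case False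
    then have "Z 0 < Y 0" using or by blast
    then have Q0: "0 < 1 - Q 0" using XY by (simp add: Q_def)
    \<comment> \<open>Chosen to cancel the negative term of \<open>gain_ge_quarter\<close>: by
      \<open>QYZ\<close> below, the derivative of the ratio contains the factor
      \<open>(X t - Y t) * (1 - Q t)\<close>, and \<open>1 - Q t\<close> never falls below
      \<open>1 - Q 0\<close>.\<close>
    define K where "K = 3 / (2 * a * (1 - Q 0))"
    have "2 * a * (1 - Q 0) \<noteq> 0" using Q0 a by simp
    then have K: "0 \<le> K" "K * (2 * a * (1 - Q 0)) = 3"
      using Q0 a nonzero_eq_divide_eq[of "2 * a * (1 - Q 0)" K 3] by (simp_all add: K_def)
    have "2 * (1 - 4 * a) * (X t)\<^sup>2 \<le> gain a (X t) (Y t) (Z t)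
      + K * (Q t * (2 * a * ((Y t - Z t) * (X t + Y t + Z t))))" if t: "t \<in> J" for t
    proof -
      have "Q t * (X t - Z t) = X t - Y t" using gap[OF t] by (simp add: Q_def)
      then have QYZ: "Q t * (Y t - Z t) = (X t - Y t) * (1 - Q t)" by (simp add: algebra_simps)
      have "Q t \<le> Q 0" unfolding Q_def
        using t by (intro ratio_antimono XY) (auto simp: time_interval_def)
      have "3 * (X t * (X t - Y t)) = K * (2 * a * (1 - Q 0)) * (X t * (X t - Y t))"
        unfolding K(2) ..
      also have "\<dots> = K * (2 * a * (((X t - Y t) * (1 - Q 0)) * X t))"
        by (simp only: mult_ac)
      also have "\<dots> \<le> K * (2 * a * (((X t - Y t) * (1 - Q t)) * (X t + Y t + Z t)))"
        using K(1) a gap[OF t] pos[OF t, of i] pos[OF t, of j] pos[OF t, of k] \<open>Q t \<le> Q 0\<close> Q0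
        by (intro mult_left_mono mult_mono) auto
      also have "\<dots> = K * (Q t * (2 * a * ((Y t - Z t) * (X t + Y t + Z t))))"
        unfolding QYZ[symmetric] by (simp add: mult_ac)
      finally show ?thesis
        using gain_ge_quarter[of a "Z t" "Y t" "X t"] a a4 pos[OF t, of k] order(1,2)[OF t] by linarith
    qed
    then show ?thesis using K(1) a4 by (intro exI[of _ "2 * (1 - 4 * a)"] exI[of _ K]) simp
  qed
  then obtain c K where c: "0 < c" and K: "0 \<le> K" and growth: "\<And>t. t \<in> J \<Longrightarrow> c * (X t)\<^sup>2
      \<le> gain a (X t) (Y t) (Z t) + K * (Q t * (2 * a * ((Y t - Z t) * (X t + Y t + Z t))))"
    by blast
  have distrib: "3 * (g + K * (q * (2 * a * m))) / v = 3 * g / v + K * (q * (6 * a * m / v))"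
    for g q m v :: real
    by (simp add: add_divide_distrib distrib_left mult_ac)
  show False
  proof (rule no_bounded_functional[OF tr a ijk c functional_deriv[OF _ XY]])
    fix t assume t: "t \<in> J"
    have "c * load (X t) (Y t) (Z t) \<le> 3 * (c * (X t)\<^sup>2) / V t"
      unfolding V_def using load_le[OF t] c by simp
    also have "\<dots> \<le> 3 * (gain a (X t) (Y t) (Z t)
        + K * (Q t * (2 * a * ((Y t - Z t) * (X t + Y t + Z t))))) / V t"
      using growth[OF t] V[OF t] by (intro divide_right_mono) auto
    also have "\<dots> = 3 * gain a (X t) (Y t) (Z t) / V t
        + K * (Q t * (6 * a * ((Y t - Z t) * (X t + Y t + Z t)) / V t))"
      by (rule distrib)
    finally show "c * load (X t) (Y t) (Z t) \<le> 3 * gain a (X t) (Y t) (Z t) / (X t * Y t * Z t)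
        + K * ((X t - Y t) / (X t - Z t) * (6 * a * ((Y t - Z t) * (X t + Y t + Z t)) / (X t * Y t * Z t)))"
      unfolding V_def Q_def .
    \<comment> \<open>This gives ln (X - Y) - 2 ln Z \<le> - ln X; together with 2 ln (X - Z) \<le>
      2 ln X the logarithms of the functional sum to at most 0.\<close>
    have "ln (X t * (X t - Y t)) \<le> ln ((Z t)\<^sup>2)"
      using gam3_nonneg_imp[OF pos[OF t] order(1,2)[OF t] \<gamma>[OF t]] gap[OF t] pos[OF t, of i] pos[OF t, of k]
      by (subst ln_le_cancel_iff) auto
    then have "ln (X t) + ln (X t - Y t) \<le> 2 * ln (Z t)"
      using gap[OF t] pos[OF t, of i] pos[OF t, of k] by (simp add: ln_mult ln_realpow)
    moreover have "ln (X t - Z t) \<le> ln (X t)" using gap[OF t] pos[OF t, of i] pos[OF t, of k] by simp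
    moreover have "0 \<le> K * ((X t - Y t) / (X t - Z t))" using K gap[OF t] by simp
    ultimately show "ln (X t - Y t) + 2 * ln (X t - Z t) - ln (X t) - 2 * ln (Z t)
      - K * ((X t - Y t) / (X t - Z t)) \<le> 0" by linarith
  qed
qed

text \<open>The mirror image of \<open>leaves_region\<close>: above 1/4 \<open>gain\<close> is at
  most a negative multiple of X^2, so the negated functional grows, already with
  \<open>K = 0\<close>.\<close>

lemma enters_region:
  assumes a4: "1/4 < a" and XY: "Y 0 < X 0"
  shows "\<exists>t\<in>J. 0 < \<gamma> t"
proof (rule ccontr)
  assume "\<not> (\<exists>t\<in>J. 0 < \<gamma> t)"
  then have \<gamma>: "\<gamma> t \<le> 0" if "t \<in> J" for t using that by force
  define V where "V t = X t * Y t * Z t" for t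
  have V: "0 < V t" if "t \<in> J" for t unfolding V_def using pos[OF that] by (intro mult_pos_pos)
  have gap: "0 < X t - Y t" "0 < X t - Z t" if "t \<in> J" for t using order[OF that] XY by auto
  define c where "c = (4 * a - 1) / 2"
  have c: "0 < c" using a4 by (simp add: c_def)
  show False
  proof (rule no_bounded_functional[OF tr a ijk c DERIV_minus[OF functional_deriv[where K = 0, OF _ XY]]])
    fix t assume t: "t \<in> J"
    have "c * load (X t) (Y t) (Z t) \<le> 3 * (c * (X t)\<^sup>2) / V t"
      unfolding V_def using load_le[OF t] c by simp
    also have "\<dots> \<le> 3 * (- gain a (X t) (Y t) (Z t)) / V t"
      using gain_le[OF a4 a(2) pos[OF t] order(1,2)[OF t]] V[OF t]
      by (intro divide_right_mono) (auto simp: c_def)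
    finally show "c * load (X t) (Y t) (Z t) \<le> - (3 * gain a (X t) (Y t) (Z t) / (X t * Y t * Z t)
        + 0 * ((X t - Y t) / (X t - Z t) * (6 * a * ((Y t - Z t) * (X t + Y t + Z t)) / (X t * Y t * Z t))))"
      unfolding V_def by simp
    \<comment> \<open>The final bound \<open>3 * ln 4\<close> collects one \<open>ln 4\<close> from
      this estimate and two from the estimate of X - Z, which enters with weight 2.\<close>
    have "ln ((Z t)\<^sup>2) \<le> ln (4 * (X t * (X t - Y t)))"
      using gam3_nonpos_imp(1)[OF pos[OF t] order(1,2)[OF t] \<gamma>[OF t]] gap[OF t] pos[OF t, of i] pos[OF t, of k]
      by (subst ln_le_cancel_iff) auto
    then have "2 * ln (Z t) \<le> ln 4 + (ln (X t) + ln (X t - Y t))"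
      using gap[OF t] pos[OF t, of i] pos[OF t, of k] by (simp add: ln_mult ln_realpow)
    moreover have "ln (X t) \<le> ln (4 * (X t - Z t))"
      using gam3_nonpos_imp(2)[OF pos[OF t] order(1,2)[OF t] \<gamma>[OF t]] gap[OF t] pos[OF t, of i] pos[OF t, of k]
      by (subst ln_le_cancel_iff) auto
    moreover have "ln (4 * (X t - Z t)) = ln 4 + ln (X t - Z t)"
      using gap[OF t] by (intro ln_mult_pos) simp_all
    ultimately show "- (ln (X t - Y t) + 2 * ln (X t - Z t) - ln (X t) - 2 * ln (Z t)
      - 0 * ((X t - Y t) / (X t - Z t))) \<le> 3 * ln 4" by simp
  qed
qed

text \<open>Between 3/14 and 1/4: to get from \<gamma> > 0 down to \<gamma> \<le> 0, \<Psi> must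
  have been negative at some earlier time. It stays negative from then on, which forbids coming
  back. The condition \<open>start\<close> excludes a start outside while \<Psi> is still positive,
  where a trajectory may first enter.\<close>

lemma no_return:
  assumes a4: "a < 1/4" and XY: "Y 0 < X 0" and or: "Z 0 < Y 0 \<or> a < 3/14"
    and start: "a \<le> 3/14 \<or> 0 < \<gamma> 0"
    and t: "t \<in> J" "0 \<le> s" "s < t" and s: "\<gamma> s \<le> 0"
  shows "\<gamma> t < 0"
proof (cases "a \<le> 3/14")
  case True
  then obtain m where "0 < m" "\<gamma> t < m * \<gamma> s" using gam3_le_3_14(2)[OF True t XY or] by blast
  then show ?thesis using s by (metis less_le_trans mult_nonneg_nonpos less_imp_le order_trans)
next
  case False
  then have g0: "0 < \<gamma> 0" using start by blast
  then have "0 < s" using s t(2) by (cases "s = 0") auto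
  have sJ: "s \<in> J" using sub[OF t(1,2)] t(3) by auto
  obtain m e r where *: "0 < m" "0 < e" "r \<in> {0<..<s}"
    "\<gamma> s = m * \<gamma> 0 + e * ((X r - Y r) * (X r - Z r) * \<Psi> r)"
    using gam3_step[OF sJ order_refl \<open>0 < s\<close>] by blast
  have r: "r \<in> J" using sub[OF sJ order_refl] *(3) by auto
  have gap: "0 < (X u - Y u) * (X u - Z u)" if "u \<in> J" for u
    using order[OF that] XY by (intro mult_pos_pos) auto
  have "0 < m * \<gamma> 0" using * g0 by simp
  then have "e * ((X r - Y r) * (X r - Z r) * \<Psi> r) < 0" using s *(4) by linarith
  moreover have "0 \<le> e * ((X r - Y r) * (X r - Z r) * \<Psi> r)" if "0 \<le> \<Psi> r"
    using *(2) gap[OF r] that by (intro mult_nonneg_nonneg[of e] mult_nonneg_nonneg[of "_ * _"]) auto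
  ultimately have neg: "\<Psi> r < 0" by linarith
  obtain m' e' r' where **: "0 < m'" "0 < e'" "r' \<in> {s<..<t}"
    "\<gamma> t = m' * \<gamma> s + e' * ((X r' - Y r') * (X r' - Z r') * \<Psi> r')"
    using gam3_step[OF t] by blast
  have r': "r' \<in> J" using sub[OF t(1,2)] **(3) by auto
  have "\<Psi> r' < 0"
    using False a4 *(3) **(3) by (intro Psi_stays_negative[OF _ _ XY r' _ _ neg]) auto
  then have "e' * ((X r' - Y r') * (X r' - Z r') * \<Psi> r') < 0"
    using **(2) gap[OF r'] by (intro mult_pos_neg) auto
  moreover have "m' * \<gamma> s \<le> 0" using **(1) s by (simp add: mult_nonneg_nonpos)
  ultimately show ?thesis using **(4) by linarith
qed

lemma exits_once:
  assumes a4: "a < 1/4" and XY: "Y 0 < X 0" and or: "Z 0 < Y 0 \<or> a < 3/14"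
    and start: "a \<le> 3/14 \<or> 0 < \<gamma> 0" and g0: "0 \<le> \<gamma> 0"
  shows "\<exists>t0\<in>J. (\<forall>t\<in>{0..t0}. 0 \<le> \<gamma> t) \<and> (\<forall>t\<in>J. t0 < t \<longrightarrow> \<gamma> t < 0)"
proof -
  note later = no_return[OF a4 XY or start]
  obtain t1 where t1: "t1 \<in> J" "\<gamma> t1 < 0" using leaves_region[OF a4 XY or] by blast
  have t10: "0 \<le> t1" using t1(1) by (simp add: time_interval_def)
  \<comment> \<open>The exit time \<open>t0\<close> is the last element of this compact set.
    Negative values before \<open>t0\<close> are impossible, since by \<open>no_return\<close> they
    would persist up to \<open>t0\<close>.\<close>
  define A where "A = {t \<in> {0..t1}. 0 \<le> \<gamma> t}"
  have "continuous_on {0..t1} \<gamma>"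
    unfolding gam3_def by (intro continuous_intros component_continuous sub[OF t1(1) order_refl])
  then have "closed A"
    unfolding A_def
    by (intro continuous_on_closed_Collect_le continuous_on_const closed_atLeastAtMost)
  moreover have "{0..t1} \<inter> A = A" by (auto simp: A_def)
  ultimately have "compact A" using compact_Int_closed[of "{0..t1}" A] by simp
  moreover have "A \<noteq> {}" using g0 t10 by (auto simp: A_def intro: exI[of _ 0])
  ultimately obtain t0 where t0: "t0 \<in> A" "\<And>t. t \<in> A \<Longrightarrow> t \<le> t0"
    using compact_attains_sup by metis
  have t0J: "t0 \<in> J" using t0(1) sub[OF t1(1) order_refl] by (auto simp: A_def)
  have "0 \<le> \<gamma> t" if "t \<in> {0..t0}" for t
  proof (rule ccontr)
    assume "\<not> 0 \<le> \<gamma> t"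
    then have "t < t0" "\<gamma> t \<le> 0" using that t0(1) by (auto simp: A_def less_le)
    then have "\<gamma> t0 < 0" using that by (intro later[OF t0J]) auto
    then show False using t0(1) by (simp add: A_def)
  qed
  moreover have "\<gamma> t < 0" if "t \<in> J" "t0 < t" for t
  proof (cases "t \<le> t1")
    case True
    then have "t \<notin> A" using t0(2)[of t] that by auto
    then show ?thesis using True that t0(1) by (auto simp: A_def)
  next
    case False
    then show ?thesis using t1 t10 that by (intro later[of t t1]) auto
  qed
  ultimately show ?thesis using t0J by blast
qed

end

section \<open>From the sign of \<gamma> back to the sets of the statement\<close>

context sorted_trajectory
begin

lemma gam_eqs:
  assumes t: "t \<in> J"
  shows "gam i (x t) = \<gamma> t" "0 < gam j (x t)" "0 < gam k (x t)"
  using gam3_pos(1) pos[OF t] order(1,2)[OF t]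
  by (auto simp: gam_eq_gam3[OF ijk] gam_eq_gam3[OF perms(2)] gam_eq_gam3[OF perms(4)])

lemma closure_iff: "t \<in> J \<Longrightarrow> x t \<in> phase_closure S_set \<longleftrightarrow> 0 \<le> \<gamma> t"
  using in_phase[of t] gam_eqs[of t] unfolding phase_closure_S
  by (simp add: all_index3[OF ijk] less_imp_le)

lemma ext_iff: "t \<in> J \<Longrightarrow> x t \<in> phase_ext S_set \<longleftrightarrow> \<gamma> t < 0"
  using in_phase[of t] closure_iff[of t] unfolding phase_ext_def by auto

lemma S_iff:
  assumes t: "t \<in> J"
  shows "x t \<in> S_set \<longleftrightarrow> 0 < \<gamma> t \<and> Z 0 < X 0"
proof -
  have "(\<exists>r. x t = vec r \<and> 0 < r) \<longleftrightarrow> \<not> Z t < X t"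
  proof
    assume "\<not> Z t < X t"
    then have "\<forall>l. x t $ l = X t" unfolding all_index3[OF ijk] using order(1,2)[OF t] by linarith
    then have "x t = vec (X t)" by (simp add: vec_eq_iff)
    then show "\<exists>r. x t = vec r \<and> 0 < r" using pos[OF t] by blast
  qed auto
  then have "x t \<notin> {vec r | r. 0 < r} \<longleftrightarrow> Z 0 < X 0" using order(5)[OF t] by blast
  moreover have "(\<forall>l. 0 < gam l (x t)) \<longleftrightarrow> 0 < \<gamma> t"
    using gam_eqs[OF t] unfolding all_index3[OF ijk] by auto
  ultimately show ?thesis using in_phase[OF t] unfolding S_set_def by blast
qed

lemma closure_ext_start:
  assumes "x 0 \<in> phase_closure (phase_ext S_set)"
  shows "\<gamma> 0 \<le> 0" "Y 0 < X 0"
proof -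
  obtain l where l: "gam l (x 0) \<le> 0" using closure_ext_imp_gam_nonpos(2)[OF assms] by blast
  moreover have "l \<in> {i, j, k}" using ijk by simp
  ultimately show "\<gamma> 0 \<le> 0" using gam_eqs[OF zero] by auto
  then show "Y 0 < X 0" by (rule gam3_nonpos_imp_max[OF pos[OF zero] pos[OF zero] pos[OF zero]])
qed

lemma reaches_ext_onceI:
  assumes "a < 1/4" "Y 0 < X 0" "Z 0 < Y 0 \<or> a < 3/14" "a \<le> 3/14 \<or> 0 < \<gamma> 0" "0 \<le> \<gamma> 0"
  shows "reaches_ext_once T x"
proof -
  obtain t0 where t0: "t0 \<in> J" "\<forall>t\<in>{0..t0}. 0 \<le> \<gamma> t" "\<forall>t\<in>J. t0 < t \<longrightarrow> \<gamma> t < 0"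
    using exits_once[OF assms] by blast
  have "x t \<in> phase_closure S_set" if "t \<in> {0..t0}" for t
  proof -
    have "t \<in> J" using that sub[OF t0(1) order_refl] by blast
    then show ?thesis using t0(2) that closure_iff by blast
  qed
  then show ?thesis unfolding reaches_ext_once_def using t0 ext_iff by blast
qed

lemma ext_never_reaches:
  assumes "a \<le> 3/14" "x 0 \<in> phase_ext S_set"
  shows "\<not> reaches T x (phase_closure S_set)"
proof -
  have g0: "\<gamma> 0 < 0" using assms(2) ext_iff[OF zero] by blast
  have "\<gamma> t < 0" if t: "t \<in> J" for t
  proof (cases "t = 0")
    case False
    then have "0 < t" using t by (simp add: time_interval_def)
    then obtain m where "0 < m" "\<gamma> t \<le> m * \<gamma> 0"
      using gam3_le_3_14(1)[OF assms(1) t order_refl] by blast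
    moreover have "m * \<gamma> 0 < 0" using \<open>0 < m\<close> g0 by (rule mult_pos_neg)
    ultimately show ?thesis by linarith
  qed (use g0 in simp)
  then show ?thesis unfolding reaches_def using closure_iff by force
qed

lemma remains_S:
  assumes "1/4 \<le> a" "x 0 \<in> S_set"
  shows "remains T x S_set"
proof -
  have g0: "0 < \<gamma> 0" "Z 0 < X 0" using assms(2) S_iff[OF zero] by blast+
  have "0 < \<gamma> t" if t: "t \<in> J" for t
  proof (cases "t = 0")
    case False
    then have "0 < t" using t by (simp add: time_interval_def)
    then obtain m where "0 < m" "m * \<gamma> 0 \<le> \<gamma> t"
      using gam3_ge_quarter(1)[OF assms(1) t order_refl] by blast
    moreover have "0 < m * \<gamma> 0" using \<open>0 < m\<close> g0(1) by (rule mult_pos_pos)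
    ultimately show ?thesis by linarith
  qed (use g0 in simp)
  then show ?thesis unfolding remains_def using S_iff g0(2) by blast
qed

lemma reaches_S:
  assumes "1/4 < a" "x 0 \<in> phase_closure (phase_ext S_set)"
  shows "reaches T x S_set"
proof -
  have XY: "Y 0 < X 0" using closure_ext_start[OF assms(2)] by blast
  then have "Z 0 < X 0" using sorted by simp
  then show ?thesis using enters_region[OF assms(1) XY] S_iff unfolding reaches_def by blast
qed

end

section \<open>The exceptional curves, and the five cases\<close>

lemma I_set_memI:
  assumes "u \<in> phase" "{i, j, k} = UNIV" "u $ j = u $ k"
  shows "u \<in> I_set" "u $ i \<le> u $ j \<Longrightarrow> u \<in> I_set'"
proof -
  define p where "p = u $ j"
  define c where "c = u $ i * p\<^sup>2"
  have pos: "0 < u $ l" for l using assms(1) by (simp add: phase_def)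
  have p: "0 < p" "0 < c" using pos[of i] pos[of j] by (simp_all add: p_def c_def)
  have i: "u $ i = c / p\<^sup>2" using p by (simp add: c_def)
  have others: "u $ l = p" if "l \<noteq> i" for l
  proof -
    have "l \<in> {i, j, k}" using assms(2) by simp
    then show ?thesis using that assms(3) by (auto simp: p_def)
  qed
  show "u \<in> I_set" unfolding I_set_def I_curve_def using p i others by blast
  assume "u $ i \<le> u $ j"
  then have "c \<le> p ^ 3" using p unfolding c_def p_def[symmetric] power3_eq_cube power2_eq_square mult.assoc
    by (intro mult_right_mono) auto
  then have "root 3 c \<le> root 3 (p ^ 3)" by simp
  then have "root 3 c \<le> p" using p by (simp add: real_root_power_cancel)
  then show "u \<in> I_set'" unfolding I_set'_def I_curve'_def using p i others by blast
qed

lemma sorted_trajectoryI: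
  assumes "0 < a" "a < 1/2" "trajectory a T x"
  obtains i j k where "sorted_trajectory a T x i j k"
  using sorted_index3[of "x 0"] assms unfolding sorted_trajectory_def by metis

lemma sorted_trajectory_exists:
  assumes a: "0 < a" "a < 1/2" and "0 < v3" "v3 \<le> v2" "v2 \<le> v1"
  obtains T x where "sorted_trajectory a T x 1 2 3" "x 0 \<in> phase"
    "x 0 $ 1 = v1" "x 0 $ 2 = v2" "x 0 $ 3 = v3"
proof -
  define u :: "real ^ 3" where "u = vector [v1, v2, v3]"
  have u: "u $ 1 = v1" "u $ 2 = v2" "u $ 3 = v3" by (simp_all add: u_def)
  have "u \<in> phase" using assms u by (simp add: phase_def forall_3)
  then obtain T x where Tx: "trajectory a T x" "x 0 = u" using trajectory_exists by blast
  have "{1, 2, 3} = (UNIV :: 3 set)" by (simp add: UNIV_3)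
  then have "sorted_trajectory a T x 1 2 3" using assms Tx u by unfold_locales simp_all
  then show thesis using that Tx u \<open>u \<in> phase\<close> by simp
qed

theorem theorem1:
  fixes a :: real
  assumes "0 < a" and "a < 1/2"
  shows
    "(a < 3/14 \<longrightarrow>
        (\<forall>T x. trajectory a T x \<and> x 0 \<in> phase_closure S_set - I_set' \<longrightarrow> reaches_ext_once T x) \<and>
        \<not> (\<exists>T x. trajectory a T x \<and> x 0 \<in> phase_ext S_set \<and> reaches T x (phase_closure S_set)))
   \<and> (a = 3/14 \<longrightarrow>
        (\<forall>T x. trajectory a T x \<and> x 0 \<in> phase_closure S_set - I_set \<longrightarrow> reaches_ext_once T x) \<and>
        \<not> (\<exists>T x. trajectory a T x \<and> x 0 \<in> phase_ext S_set \<and> reaches T x (phase_closure S_set)))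
   \<and> (3/14 < a \<and> a < 1/4 \<longrightarrow>
        (\<exists>T x. trajectory a T x \<and> x 0 \<in> phase_closure (phase_ext S_set) \<and>
          (\<exists>s\<in>time_interval T. \<exists>t\<in>time_interval T.
             s < t \<and> x s \<in> S_set \<and> x t \<in> phase_closure (phase_ext S_set))) \<and>
        (\<forall>T x. trajectory a T x \<and> x 0 \<in> S_set - I_set \<longrightarrow> reaches_ext_once T x))
   \<and> (1/4 < a \<longrightarrow>
        (\<forall>T x. trajectory a T x \<and> x 0 \<in> S_set \<longrightarrow> remains T x S_set) \<and>
        (\<forall>T x. trajectory a T x \<and> x 0 \<in> phase_closure (phase_ext S_set) \<longrightarrow> reaches T x S_set))
   \<and> (a = 1/4 \<longrightarrow>
        (\<forall>T x. trajectory a T x \<and> x 0 \<in> S_set \<longrightarrow> remains T x S_set) \<and>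
        (\<exists>T x. trajectory a T x \<and> x 0 \<in> phase_closure (phase_ext S_set) \<and> reaches T x S_set))"
proof -
  have ordered: "\<exists>i j k. sorted_trajectory a T x i j k" if "trajectory a T x" for T x
    using sorted_trajectoryI[OF assms that] by metis
  have never: "\<not> (\<exists>T x. trajectory a T x \<and> x 0 \<in> phase_ext S_set \<and> reaches T x (phase_closure S_set))"
    if "a \<le> 3/14"
    using ordered sorted_trajectory.ext_never_reaches that by blast
  \<comment> \<open>One statement for the first three ranges of \<open>a\<close>; above 3/14 the
    start must lie in \<open>S_set\<close> itself, so that \<gamma> is positive there.\<close>
  have once: "reaches_ext_once T x"
    if tr: "trajectory a T x" and start: "x 0 \<in> phase_closure S_set" and a4: "a < 1/4"
      and I: "x 0 \<notin> I_set' \<and> a < 3/14 \<or> x 0 \<notin> I_set \<and> (a \<le> 3/14 \<or> x 0 \<in> S_set)" for T x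
  proof -
    obtain i j k where "sorted_trajectory a T x i j k" using ordered[OF tr] by blast
    then interpret sorted_trajectory a T x i j k .
    note mem = I_set_memI[OF in_phase[OF zero]]
    show ?thesis
    proof (rule reaches_ext_onceI[OF a4])
      \<comment> \<open>Two equal largest coordinates put the start on both \<open>I_set\<close> and
        \<open>I_set'\<close>; two equal smallest ones are only known to put it on
        \<open>I_set\<close>, whence the weaker conclusion in the next goal.\<close>
      show "Y 0 < X 0"
        using I mem[OF perms(5)] mem[OF perms(4)] sorted by (metis order_le_imp_less_or_eq)
      show "Z 0 < Y 0 \<or> a < 3/14"
        using I mem(1)[OF ijk] sorted by (metis order_le_imp_less_or_eq)
      show "a \<le> 3/14 \<or> 0 < \<gamma> 0" using I S_iff[OF zero] by auto
      show "0 \<le> \<gamma> 0" using start closure_iff[OF zero] by blast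
    qed
  qed
  have S_closure: "S_set \<subseteq> phase_closure S_set"
    using closure_subset[of S_set] S_set_subset_phase by (simp add: phase_closure_eq)
  have stay: "remains T x S_set" if "1/4 \<le> a" "trajectory a T x" "x 0 \<in> S_set" for T x
    using ordered[OF that(2)] sorted_trajectory.remains_S that by blast
  have enter: "reaches T x S_set"
    if "1/4 < a" "trajectory a T x" "x 0 \<in> phase_closure (phase_ext S_set)" for T x
    using ordered[OF that(2)] sorted_trajectory.reaches_S that by blast
  have return: "\<exists>T x. trajectory a T x \<and> x 0 \<in> phase_closure (phase_ext S_set) \<and>
      (\<exists>s\<in>time_interval T. \<exists>t\<in>time_interval T.
         s < t \<and> x s \<in> S_set \<and> x t \<in> phase_closure (phase_ext S_set))"
    if a3: "3/14 < a" "a < 1/4"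
  proof -
    \<comment> \<open>On the surface with X = 1 the roots of 1 - Y and 1 - Z add up to 1; they are
      taken to be 1/2 - d and 1/2 + d. A positive \<open>d\<close> gives Z < Y, which makes the
      trajectory leave in the end; taking \<open>d\<close> proportional to the excess of
      \<open>a\<close> over 3/14 keeps it so near to Y = Z that \<Psi> is positive and the
      trajectory enters first.\<close>
    define d where "d = (42 * a - 9) / 8"
    have d: "0 < d" "d < 1/4" using a3 by (auto simp: d_def)
    define v2 v3 where "v2 = 1 - (1/2 - d)\<^sup>2" and "v3 = 1 - (1/2 + d)\<^sup>2"
    have "(1/2 + d)\<^sup>2 < 1\<^sup>2" using d by (intro power_strict_mono) auto
    moreover have "(1/2 - d)\<^sup>2 < (1/2 + d)\<^sup>2" "0 < (1/2 - d)\<^sup>2" using d by (auto intro!: power_strict_mono)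
    ultimately have v: "0 < v3" "v3 < v2" "v2 < 1" by (simp_all add: v2_def v3_def)
    obtain T x where "sorted_trajectory a T x 1 2 3" and ph: "x 0 \<in> phase"
      and x0: "x 0 $ 1 = 1" "x 0 $ 2 = v2" "x 0 $ 3 = v3"
      using sorted_trajectory_exists[OF assms v(1), of v2 1] v by (metis less_imp_le)
    then interpret sorted_trajectory a T x 1 2 3 by simp
    have roots: "sqrt (1 - v2) = 1/2 - d" "sqrt (1 - v3) = 1/2 + d"
      using d by (simp_all add: v2_def v3_def)
    have g0: "\<gamma> 0 = 0"
      unfolding x0 using gam3_factor[of v2 1 v3] v unfolding roots by simp
    have "d * (10 * a - 1) < 1/4 * 2" using d a3 by (intro mult_strict_mono) auto
    then have "0 < 2 * d * (2 - d * (10 * a - 1))" using d by (intro mult_pos_pos) auto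
    moreover have "a = (8 * d + 9) / 42" by (simp add: d_def field_simps)
    then have "\<Psi> 0 = 2 * d * (2 - d * (10 * a - 1))"
      unfolding x0 Psi_def roots by (simp add: v2_def v3_def field_simps power2_eq_square)
    ultimately have Psi: "0 < \<Psi> 0" by simp
    have cl: "x 0 \<in> phase_closure (phase_ext S_set)"
      by (rule gam_zero_in_closure_ext[OF ph]) (use gam_eqs(1)[OF zero] g0 in simp)
    have XYZ: "x 0 $ 2 < x 0 $ 1" "x 0 $ 3 < x 0 $ 2" unfolding x0 using v by simp_all
    obtain t where t: "t \<in> J" "\<gamma> t < 0" using leaves_region[OF a3(2) XYZ(1)] XYZ(2) by blast
    have "0 < t" using t g0 by (cases "t = 0") (auto simp: time_interval_def)
    \<comment> \<open>As \<gamma> vanishes at time 0, the inhomogeneous term is its whole derivative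
      there.\<close>
    define D where "D = 6 * X 0 / (X 0 * Y 0 * Z 0) * ((X 0 - Y 0) * (X 0 - Z 0) * \<Psi> 0)"
    have "(\<gamma> has_real_derivative D) (at 0 within J)"
      using gam3_deriv[OF zero] unfolding g0 D_def by simp
    moreover have "0 < D"
      unfolding D_def using pos[OF zero] XYZ Psi by (intro mult_pos_pos divide_pos_pos) auto
    ultimately obtain e where e: "0 < e" "\<And>h. 0 < h \<Longrightarrow> 0 + h \<in> J \<Longrightarrow> h < e \<Longrightarrow> \<gamma> 0 < \<gamma> (0 + h)"
      using has_real_derivative_pos_inc_right[of \<gamma> D 0 J] by blast
    define s where "s = min e t / 2"
    have s: "0 < s" "s < e" "s < t" using e \<open>0 < t\<close> by (auto simp: s_def)
    have "s \<in> J" using sub[OF t(1) order_refl] s by auto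
    then have "0 < \<gamma> s" using e(2)[of s] s g0 by simp
    then have "x s \<in> S_set" using S_iff[OF \<open>s \<in> J\<close>] XYZ by simp
    moreover have "x t \<in> phase_closure (phase_ext S_set)"
      using ext_iff[OF t(1)] t(2) closure_subset[of "phase_ext S_set"] phase_ext_subset_phase[of S_set]
      by (auto simp: phase_closure_eq)
    ultimately show ?thesis using tr cl \<open>s \<in> J\<close> t(1) s(3) by blast
  qed
  have touch: "\<exists>T x. trajectory a T x \<and> x 0 \<in> phase_closure (phase_ext S_set) \<and> reaches T x S_set"
    if a4: "a = 1/4"
  proof -
    \<comment> \<open>A point of the surface with integer coordinates: both roots of the differences
      are 1 and add up to the root of 4. At a = 1/4 \<Psi> is positive whenever Y < X, so \<gamma>
      becomes positive immediately.\<close>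
    obtain T x where "sorted_trajectory a T x 1 2 3" and ph: "x 0 \<in> phase"
      and x0: "x 0 $ 1 = 4" "x 0 $ 2 = 3" "x 0 $ 3 = 3"
      by (rule sorted_trajectory_exists[OF assms, of 3 3 4]) simp_all
    then interpret sorted_trajectory a T x 1 2 3 by simp
    have g0: "\<gamma> 0 = 0" unfolding x0 gam3_def by simp
    have cl: "x 0 \<in> phase_closure (phase_ext S_set)"
      by (rule gam_zero_in_closure_ext[OF ph]) (use gam_eqs(1)[OF zero] g0 in simp)
    have "0 < T" using tr by (simp add: trajectory_def)
    then obtain t where t: "0 < t" "t \<in> J"
      using ereal_dense2[of 0 T] by (auto simp: time_interval_def zero_ereal_def)
    have "0 < \<gamma> t"
      using gam3_ge_quarter(2)[OF _ t(2) order_refl t(1)] a4 g0 x0 by auto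
    then have "x t \<in> S_set" using S_iff[OF t(2)] x0 by simp
    then show ?thesis using tr cl t(2) unfolding reaches_def by blast
  qed
  show ?thesis
    using never once S_closure stay enter return touch by auto
qed

end
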